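(* Let $\Omega\subset\mathbb{O}$ be a domain. If $f:\Omega\to\mathbb{O}$ is a nonconstant slice Fueter-regular function, then $|f|:\Omega\to\mathbb{R}$ has no local maximum.
   Context: Octonions. $\mathbb{O}$ is the real (non-associative) division algebra with basis $e_0=1,e_1,\dots,e_7$, with $e_l e_l=-1$ for $l\ge 1$ and $e_le_m=\sum_n\epsilon_{lmn}e_n$ for $l\ne m$ in $\{1,\dots,7\}$, where $\epsilon_{lmn}$ is completely antisymmetric, equal to $1$ on $(1,2,3),(1,4,5),(1,7,6),(2,4,6),(2,5,7),(3,4,7),(3,6,5)$, and $0$ on triples that are not permutations of these. For $x=\sum_{l=0}^7x_le_l$: $\Re(x)=x_0$, $\Im(x)=\sum_{l=1}^7x_le_l$, $|x|=(\sum x_l^2)^{1/2}$. $\mathbb{O}=\mathbb{R}^8$ carries the Euclidean topology; a domain is a nonempty connected open set. $\mathbb{S}=\{I\in\mathbb{O}:\Re(I)=0,|I|=1\}$. Slice functions. For $a\in\mathbb{R}$, $b>0$ let $\mathbb{S}(\Omega,a,b)=\{I\in\mathbb{S}: a+bI\in\Omega\}$. A function $f:\Omega\to\mathbb{O}$ is a slice function if for every connected component $\Lambda$ of any nonempty $\mathbb{S}(\Omega,a,b)$ there is $(u,v)\in\mathbb{O}^2$ with $f(a+bI)=u+Iv$ for all $I\in\Lambda$. Slice Fueter-regularity. Let $L_{mn}=x_m\frac{\partial}{\partial x_n}-x_n\frac{\partial}{\partial x_m}$ ($1\le m<n\le 7$), $\Gamma f=-\sum_{1\le m<n\le 7}e_m(e_n(L_{mn}f))$,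 $E=\sum_{l=1}^7x_l\frac{\partial}{\partial x_l}$, and $\overline{\partial}_Ff(x)=\frac{\partial f}{\partial x_0}(x)-\Im(x)^{-1}Ef(x)-\frac13\Im(x)^{-1}\Gamma f(x)$ for $x\in\Omega\setminus\mathbb{R}$. A slice function $f:\Omega\to\mathbb{O}$ of class $\mathcal{C}^1$ (in the real variables $x_0,\dots,x_7$) is slice Fueter-regular if $\overline{\partial}_Ff\equiv0$ on $\Omega\setminus\mathbb{R}$. A local maximum is understood in the non-strict sense. *)

theory Defs
  imports "HOL-Analysis.Analysis"
begin

text \<open>
  Octonions are the vectors of \<open>real ^ 8\<close>, with \<open>x $ l\<close> the coordinate of \<open>x\<close> along the
  basis element of index \<open>l\<close>. The index type \<open>8\<close> consists of the residues \<open>0, \<dots>, 7\<close> modulo 8,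
  linearly ordered as these numbers. The norm and the topology of \<open>real ^ 8\<close> are the Euclidean ones.
  Note that the library's \<open>1\<close> and \<open>*\<close> on vectors are componentwise and are not the
  octonionic ones; the octonionic unit is \<open>oct_e 0\<close> and the octonionic product is \<open>\<odot>\<close>.
\<close>

type_synonym octonion = "real ^ 8"

definition oct_e :: "8 \<Rightarrow> octonion" where
  "oct_e l = axis l 1"

definition oct_triples :: "(8 \<times> 8 \<times> 8) set" where
  "oct_triples = {(1,2,3), (1,4,5), (1,7,6), (2,4,6), (2,5,7), (3,4,7), (3,6,5)}"

definition oct_eps :: "8 \<Rightarrow> 8 \<Rightarrow> 8 \<Rightarrow> real" where
  "oct_eps l m n =
    (if {(l,m,n), (m,n,l), (n,l,m)} \<inter> oct_triples \<noteq> {} then 1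
     else if {(m,l,n), (l,n,m), (n,m,l)} \<inter> oct_triples \<noteq> {} then -1
     else 0)"

definition oct_basis_mult :: "8 \<Rightarrow> 8 \<Rightarrow> octonion" where
  "oct_basis_mult l m =
    (if l = 0 then oct_e m
     else if m = 0 then oct_e l
     else if l = m then - oct_e 0
     else (\<Sum>n | 1 \<le> n. oct_eps l m n *\<^sub>R oct_e n))"

definition oct_mult :: "octonion \<Rightarrow> octonion \<Rightarrow> octonion"  (infixl "\<odot>" 70) where
  "x \<odot> y = (\<Sum>l\<in>UNIV. \<Sum>m\<in>UNIV. (x $ l * y $ m) *\<^sub>R oct_basis_mult l m)"

definition oct_of_real :: "real \<Rightarrow> octonion" where
  "oct_of_real a = a *\<^sub>R oct_e 0"

definition oct_Re :: "octonion \<Rightarrow> real" where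
  "oct_Re x = x $ 0"

definition oct_Im :: "octonion \<Rightarrow> octonion" where
  "oct_Im x = (\<Sum>l | 1 \<le> l. x $ l *\<^sub>R oct_e l)"

text \<open>Conjugate divided by the squared norm.\<close>

definition oct_inverse :: "octonion \<Rightarrow> octonion" where
  "oct_inverse x = (1 / (norm x)\<^sup>2) *\<^sub>R (oct_of_real (oct_Re x) - oct_Im x)"

definition oct_reals :: "octonion set" where
  "oct_reals = range oct_of_real"

definition imag_units :: "octonion set" where
  "imag_units = {I. oct_Re I = 0 \<and> norm I = 1}"

definition slice_units :: "octonion set \<Rightarrow> real \<Rightarrow> real \<Rightarrow> octonion set" where
  "slice_units \<Omega> a b = {I \<in> imag_units. oct_of_real a + b *\<^sub>R I \<in> \<Omega>}"

definition slice_function :: "octonion set \<Rightarrow> (octonion \<Rightarrow> octonion) \<Rightarrow> bool" where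
  "slice_function \<Omega> f \<longleftrightarrow>
    (\<forall>a b. b > 0 \<longrightarrow> (\<forall>\<Lambda>\<in>components (slice_units \<Omega> a b).
       \<exists>u v. \<forall>I\<in>\<Lambda>. f (oct_of_real a + b *\<^sub>R I) = u + I \<odot> v))"

definition partial_deriv :: "8 \<Rightarrow> (octonion \<Rightarrow> octonion) \<Rightarrow> octonion \<Rightarrow> octonion" where
  "partial_deriv l f x = vector_derivative (\<lambda>t. f (x + t *\<^sub>R oct_e l)) (at 0)"

text \<open>Class \<open>C\<^sup>1\<close>, for open \<open>\<Omega>\<close>.\<close>

definition oct_C1_on :: "octonion set \<Rightarrow> (octonion \<Rightarrow> octonion) \<Rightarrow> bool" where
  "oct_C1_on \<Omega> f \<longleftrightarrow>
    (\<forall>x\<in>\<Omega>. f differentiable (at x)) \<and> (\<forall>l. continuous_on \<Omega> (partial_deriv l f))"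

definition oct_L :: "8 \<Rightarrow> 8 \<Rightarrow> (octonion \<Rightarrow> octonion) \<Rightarrow> octonion \<Rightarrow> octonion" where
  "oct_L m n f x = x $ m *\<^sub>R partial_deriv n f x - x $ n *\<^sub>R partial_deriv m f x"

definition oct_Gamma :: "(octonion \<Rightarrow> octonion) \<Rightarrow> octonion \<Rightarrow> octonion" where
  "oct_Gamma f x = - (\<Sum>(m, n)\<in>{(m, n). 1 \<le> m \<and> m < n}. oct_e m \<odot> (oct_e n \<odot> oct_L m n f x))"

definition oct_Euler :: "(octonion \<Rightarrow> octonion) \<Rightarrow> octonion \<Rightarrow> octonion" where
  "oct_Euler f x = (\<Sum>l | 1 \<le> l. x $ l *\<^sub>R partial_deriv l f x)"

definition dbar_F :: "(octonion \<Rightarrow> octonion) \<Rightarrow> octonion \<Rightarrow> octonion" where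
  "dbar_F f x = partial_deriv 0 f x
     - oct_inverse (oct_Im x) \<odot> oct_Euler f x
     - (1/3) *\<^sub>R (oct_inverse (oct_Im x) \<odot> oct_Gamma f x)"

definition slice_Fueter_regular :: "octonion set \<Rightarrow> (octonion \<Rightarrow> octonion) \<Rightarrow> bool" where
  "slice_Fueter_regular \<Omega> f \<longleftrightarrow>
    slice_function \<Omega> f \<and> oct_C1_on \<Omega> f \<and> (\<forall>x\<in>\<Omega> - oct_reals. dbar_F f x = 0)"

end

theory Submission
  imports Defs "HOL-Complex_Analysis.Conformal_Mappings"
begin

text \<open>
  Near a point \<open>a0 + b0 I\<close> a slice Fueter-regular function is \<open>f (a + b J) = u (a, b) + J v (a, b)\<close>,
  and the equation \<open>dbar_F f = 0\<close> becomes \<open>u_b = - v_a\<close>, \<open>u_a = v_b + 2 v / b\<close>.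
  For each real component, this system is solved by a holomorphic function \<open>H\<close> of \<open>a + i b\<close>:
  \<open>u = - (Im H / b)_a\<close> and \<open>v = (Im H / b)_b\<close>. This gives the identity theorem.
  If \<open>norm f\<close> has a local maximum at \<open>p\<close> and \<open>c = f p\<close>, then the real function \<open>f \<bullet> c\<close> has one, too.
  It is harmonic on the four-dimensional spaces that contain the real axis, and \<open>s\<close> times its mean over
  the two-sphere of points \<open>p + (a - a0) + s K\<close>, \<open>norm K = 1\<close>, is the imaginary part of a
  holomorphic function of \<open>a + i s\<close>. A sign argument in the half plane \<open>s \<ge> 0\<close> shows that this mean
  is constant, so \<open>f = c\<close> near \<open>p\<close>, and then everywhere by the identity theorem.
\<close>

subsection \<open>The stem equations\<close>

text \<open>The factor 2 in \<open>2 v / b\<close> comes from the weight 1/3 in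
  \<open>dbar_F\<close>: in \<open>oct_Gamma\<close> each of the seven imaginary indices occurs in
  six pairs, and 6/3 = 2. This is also the system of quaternionic Fueter regularity for functions u
  + J v, which explains harmonicity in four variables instead of eight and the use of two-spheres.
  On the sphere of radius s about \<open>b0 I\<close>, the square of the modulus b is affine in the
  height along I, and area is uniform in height (Archimedes). So the spherical mean is an integral
  with weight b db, and this can be evaluated by primitives of the stem functions.

  Two obstacles shape the rest. The product is not associative; only left multiplications occur, and
  for an imaginary unit J they satisfy J (J y) = - y. And a slice function has a pair (u, v) only on
  connected sets of units. Hence all analysis takes place on balls that are centred at a real point
  or avoid the real axis, and connectedness of the domain is used only at the end.\<close>

lemma closed_form_potential:
  fixes P Q Pa Pb Qb :: "complex \<Rightarrow> real"
  assumes D: "open D" "convex D"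
    and cont: "continuous_on D Pa" "continuous_on D Pb" "continuous_on D Qb"
    and P: "\<And>z. z \<in> D \<Longrightarrow> (P has_derivative (\<lambda>h. Re h * Pa z + Im h * Pb z)) (at z)"
    and Q: "\<And>z. z \<in> D \<Longrightarrow> (Q has_derivative (\<lambda>h. Re h * Pb z + Im h * Qb z)) (at z)"
  obtains \<phi> where "\<And>z. z \<in> D \<Longrightarrow> (\<phi> has_derivative (\<lambda>h. Re h * P z + Im h * Q z)) (at z)"
proof (cases "D = {}")
  case True then show ?thesis by (auto intro: that)
next
  case False
  then obtain z0 where z0: "z0 \<in> D" by blast
  define y where "y z t = z0 + t *\<^sub>R (z - z0)" for z and t :: real
  have yD: "y z t \<in> D" if "z \<in> D" "0 \<le> t" "t \<le> 1" for z t
  proof -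
    have "y z t = (1 - t) *\<^sub>R z0 + t *\<^sub>R z" by (simp add: y_def algebra_simps)
    then show ?thesis using D(2) z0 that by (simp add: convex_alt)
  qed
  have contP: "continuous_on D P" and contQ: "continuous_on D Q"
    using P Q by (meson continuous_at_imp_continuous_on has_derivative_continuous)+
  have y_cont: "continuous_on X (\<lambda>p. y (g p) (h p))"
    if "continuous_on X g" "continuous_on X h" for X :: "'z::topological_space set" and g h
    unfolding y_def by (intro continuous_intros that)
  \<comment> \<open>The potential is the integral of \<open>P da + Q db\<close> along the segment
    from \<open>z0\<close> to \<open>z\<close>. Closedness is encoded by the common
    \<open>Pb\<close>. It makes the components \<open>A\<close>, \<open>B\<close> of the
    \<open>z\<close>-derivative of the integrand equal to the \<open>t\<close>-derivatives of
    \<open>t * P (y z t)\<close> and \<open>t * Q (y z t)\<close>, which integrate to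
    \<open>P z\<close> and \<open>Q z\<close>.\<close>
  define f where "f z t = Re (z - z0) * P (y z t) + Im (z - z0) * Q (y z t)" for z t
  define A where "A z t = P (y z t) + t * (Re (z - z0) * Pa (y z t) + Im (z - z0) * Pb (y z t))" for z t
  define B where "B z t = Q (y z t) + t * (Re (z - z0) * Pb (y z t) + Im (z - z0) * Qb (y z t))" for z t
  define R where "R = Blinfun Re"
  define J where "J = Blinfun Im"
  have R: "blinfun_apply R = Re" and J: "blinfun_apply J = Im"
    by (simp_all add: R_def J_def bounded_linear_Blinfun_apply bounded_linear_Re bounded_linear_Im)
  define F where "F z t = A z t *\<^sub>R R + B z t *\<^sub>R J" for z t
  have Y: "((\<lambda>z. y z t) has_derivative (\<lambda>h. t *\<^sub>R h)) (at z)" for z t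
    unfolding y_def by (auto intro!: derivative_eq_intros)
  have der: "((\<lambda>z. f z t) has_derivative blinfun_apply (F z t)) (at z)"
    if "z \<in> D" "t \<in> cbox 0 1" for z t
  proof -
    have mem: "y z t \<in> D" using that yD by auto
    have 1: "((\<lambda>z. P (y z t)) has_derivative (\<lambda>h. Re (t *\<^sub>R h) * Pa (y z t) + Im (t *\<^sub>R h) * Pb (y z t))) (at z)"
      by (rule has_derivative_compose[OF Y P[OF mem]])
    have 2: "((\<lambda>z. Q (y z t)) has_derivative (\<lambda>h. Re (t *\<^sub>R h) * Pb (y z t) + Im (t *\<^sub>R h) * Qb (y z t))) (at z)"
      by (rule has_derivative_compose[OF Y Q[OF mem]])
    have "((\<lambda>z. f z t) has_derivative
      (\<lambda>h. Re (z - z0) * (Re (t *\<^sub>R h) * Pa (y z t) + Im (t *\<^sub>R h) * Pb (y z t)) + Re h * P (y z t)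
        + (Im (z - z0) * (Re (t *\<^sub>R h) * Pb (y z t) + Im (t *\<^sub>R h) * Qb (y z t)) + Im h * Q (y z t)))) (at z)"
      unfolding f_def
      apply (intro has_derivative_add has_derivative_mult 1 2)
      apply (auto intro!: derivative_eq_intros)
      done
    moreover have "blinfun_apply (F z t) = (\<lambda>h. Re (z - z0) * (Re (t *\<^sub>R h) * Pa (y z t) + Im (t *\<^sub>R h) * Pb (y z t)) + Re h * P (y z t)
        + (Im (z - z0) * (Re (t *\<^sub>R h) * Pb (y z t) + Im (t *\<^sub>R h) * Qb (y z t)) + Im h * Q (y z t)))"
      unfolding F_def A_def B_def blinfun.add_left blinfun.scaleR_left R J by (simp add: fun_eq_iff algebra_simps)
    ultimately show ?thesis by simp
  qed
  have contF: "continuous_on (D \<times> cbox 0 1) (\<lambda>(z, t). F z t)"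
    unfolding F_def A_def B_def split_beta
    by (intro continuous_intros continuous_on_compose2[OF contP] continuous_on_compose2[OF contQ]
        continuous_on_compose2[OF cont(1)] continuous_on_compose2[OF cont(2)]
        continuous_on_compose2[OF cont(3)] y_cont)
       (auto intro: yD)
  have contf: "continuous_on (cbox 0 1) (f z)" if "z \<in> D" for z
    unfolding f_def
    by (intro continuous_intros continuous_on_compose2[OF contP] continuous_on_compose2[OF contQ] y_cont)
       (use that in \<open>auto intro: yD\<close>)
  define \<phi> where "\<phi> z = integral (cbox 0 1) (f z)" for z
  have intF: "integral (cbox 0 1) (F z) = P z *\<^sub>R R + Q z *\<^sub>R J" if z: "z \<in> D" for z
  proof -
    have yt: "((\<lambda>t. y z t) has_vector_derivative (z - z0)) (at t within {0..1})" for t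
      unfolding y_def by (auto intro!: derivative_eq_intros)
    have yt': "((\<lambda>t. y z t) has_derivative (\<lambda>h. h *\<^sub>R (z - z0))) (at t within {0..1})" for t
      using yt by (simp add: has_vector_derivative_def)
    have "(A z has_integral 1 * P (y z 1) - 0 * P (y z 0)) {0..1}"
    proof (rule fundamental_theorem_of_calculus)
      fix t :: real assume t: "t \<in> {0..1}"
      then have mem: "y z t \<in> D" using z yD by auto
      have "((\<lambda>t. P (y z t)) has_derivative (\<lambda>h. Re (h *\<^sub>R (z - z0)) * Pa (y z t) + Im (h *\<^sub>R (z - z0)) * Pb (y z t)))
          (at t within {0..1})"
        by (rule has_derivative_compose[OF yt' P[OF mem]])
      then have "((\<lambda>t. t * P (y z t)) has_derivative
          (\<lambda>h. t * (Re (h *\<^sub>R (z - z0)) * Pa (y z t) + Im (h *\<^sub>R (z - z0)) * Pb (y z t)) + h * P (y z t)))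
          (at t within {0..1})"
        by (intro has_derivative_mult has_derivative_ident)
      then show "((\<lambda>t. t * P (y z t)) has_vector_derivative A z t) (at t within {0..1})"
        unfolding has_vector_derivative_def A_def by (simp add: algebra_simps)
    qed simp
    moreover have "(B z has_integral 1 * Q (y z 1) - 0 * Q (y z 0)) {0..1}"
    proof (rule fundamental_theorem_of_calculus)
      fix t :: real assume t: "t \<in> {0..1}"
      then have mem: "y z t \<in> D" using z yD by auto
      have "((\<lambda>t. Q (y z t)) has_derivative (\<lambda>h. Re (h *\<^sub>R (z - z0)) * Pb (y z t) + Im (h *\<^sub>R (z - z0)) * Qb (y z t)))
          (at t within {0..1})"
        by (rule has_derivative_compose[OF yt' Q[OF mem]])
      then have "((\<lambda>t. t * Q (y z t)) has_derivative
          (\<lambda>h. t * (Re (h *\<^sub>R (z - z0)) * Pb (y z t) + Im (h *\<^sub>R (z - z0)) * Qb (y z t)) + h * Q (y z t)))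
          (at t within {0..1})"
        by (intro has_derivative_mult has_derivative_ident)
      then show "((\<lambda>t. t * Q (y z t)) has_vector_derivative B z t) (at t within {0..1})"
        unfolding has_vector_derivative_def B_def by (simp add: algebra_simps)
    qed simp
    ultimately have "(F z has_integral P z *\<^sub>R R + Q z *\<^sub>R J) {0..1}"
      unfolding F_def by (intro has_integral_add has_integral_scaleR_left) (simp_all add: y_def)
    then show ?thesis by (simp add: integral_unique)
  qed
  have "(\<phi> has_derivative (\<lambda>h. Re h * P z + Im h * Q z)) (at z)" if z: "z \<in> D" for z
  proof -
    have "(\<phi> has_derivative integral (cbox 0 1) (F z)) (at z within D)"
      unfolding \<phi>_def
    proof (rule leibniz_rule[where U = D and f = f and fx = F])
      show "((\<lambda>x. f x t) has_derivative blinfun_apply (F x t)) (at x within D)"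
        if "x \<in> D" "t \<in> cbox 0 1" for x t
        by (rule has_derivative_at_withinI[OF der[OF that]])
      show "f x integrable_on cbox 0 1" if "x \<in> D" for x
        by (rule integrable_continuous[OF contf[OF that]])
      show "continuous_on (D \<times> cbox 0 1) (\<lambda>(z, t). F z t)" by (rule contF)
      show "z \<in> D" by (rule z)
      show "convex D" by (rule D(2))
    qed
    then have "(\<phi> has_derivative blinfun_apply (P z *\<^sub>R R + Q z *\<^sub>R J)) (at z)"
      using z D(1) by (simp add: intF at_within_open_NO_MATCH del: box_real)
    moreover have "blinfun_apply (P z *\<^sub>R R + Q z *\<^sub>R J) = (\<lambda>h. Re h * P z + Im h * Q z)"
      by (simp add: fun_eq_iff blinfun.add_left blinfun.scaleR_left R J)
    ultimately show ?thesis by simp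
  qed
  then show ?thesis by (rule that)
qed

text \<open>
  The equations satisfied by \<open>u\<close> and \<open>v\<close> when \<open>u + J v\<close> is slice Fueter-regular. Multiplying the second
  one by \<open>Im z\<close> makes it meaningful on the real axis, where it forces \<open>v = 0\<close>.
\<close>

definition stem_system ::
  "complex set \<Rightarrow> (complex \<Rightarrow> 'a::real_normed_vector) \<Rightarrow> (complex \<Rightarrow> 'a) \<Rightarrow> bool" where
  "stem_system D u v \<longleftrightarrow> (\<exists>ua ub va vb.
     continuous_on D ua \<and> continuous_on D ub \<and> continuous_on D va \<and> continuous_on D vb \<and>
     (\<forall>z\<in>D. (u has_derivative (\<lambda>h. Re h *\<^sub>R ua z + Im h *\<^sub>R ub z)) (at z) \<and>
            (v has_derivative (\<lambda>h. Re h *\<^sub>R va z + Im h *\<^sub>R vb z)) (at z) \<and>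
            ub z = - va z \<and> Im z *\<^sub>R (ua z - vb z) = 2 *\<^sub>R v z))"

text \<open>The coefficients are real and \<open>u\<close> enters only through its derivatives.
  Coordinates and functionals such as \<open>\<lambda>y. (I \<odot> y) \<bullet> c\<close> thus
  reduce octonionic pairs to real ones.\<close>

lemma stem_system_linear:
  assumes "stem_system D u v" "bounded_linear L"
  shows "stem_system D (\<lambda>z. L (u z - c)) (\<lambda>z. L (v z))"
proof -
  interpret L: bounded_linear L by fact
  obtain ua ub va vb where
    *: "continuous_on D ua" "continuous_on D ub" "continuous_on D va" "continuous_on D vb"
    and **: "\<And>z. z \<in> D \<Longrightarrow> (u has_derivative (\<lambda>h. Re h *\<^sub>R ua z + Im h *\<^sub>R ub z)) (at z)"
      "\<And>z. z \<in> D \<Longrightarrow> (v has_derivative (\<lambda>h. Re h *\<^sub>R va z + Im h *\<^sub>R vb z)) (at z)"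
      "\<And>z. z \<in> D \<Longrightarrow> ub z = - va z" "\<And>z. z \<in> D \<Longrightarrow> Im z *\<^sub>R (ua z - vb z) = 2 *\<^sub>R v z"
    using assms(1) unfolding stem_system_def by blast
  show ?thesis
    unfolding stem_system_def
  proof (intro exI conjI ballI)
    fix z assume z: "z \<in> D"
    show "((\<lambda>z. L (u z - c)) has_derivative (\<lambda>h. Re h *\<^sub>R L (ua z) + Im h *\<^sub>R L (ub z))) (at z)"
      using L.has_derivative[OF has_derivative_diff[OF **(1)[OF z] has_derivative_const]]
      by (simp add: L.add L.scaleR)
    show "((\<lambda>z. L (v z)) has_derivative (\<lambda>h. Re h *\<^sub>R L (va z) + Im h *\<^sub>R L (vb z))) (at z)"
      using L.has_derivative[OF **(2)[OF z]] by (simp add: L.add L.scaleR)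
    show "L (ub z) = - L (va z)" using **(3)[OF z] by (simp add: L.neg)
    show "Im z *\<^sub>R (L (ua z) - L (vb z)) = 2 *\<^sub>R L (v z)"
      using **(4)[OF z] by (metis L.diff L.scaleR)
  qed (intro L.continuous_on *)+
qed

text \<open>
  The form \<open>- U da + V db\<close> is closed. With a potential \<open>\<phi>\<close> of it, the function
  \<open>\<phi> + b V - i b U\<close> satisfies the Cauchy-Riemann equations, and \<open>H\<close> is a primitive of it.
\<close>

lemma stem_system_potential:
  fixes U V :: "complex \<Rightarrow> real"
  assumes D: "open D" "convex D" and "stem_system D U V"
  obtains \<phi> H where "H holomorphic_on D"
    "\<And>z. z \<in> D \<Longrightarrow> (\<phi> has_derivative (\<lambda>h. Im h * V z - Re h * U z)) (at z)"
    "\<And>z. z \<in> D \<Longrightarrow> Im (H z) = Im z * \<phi> z"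
    "\<And>z. z \<in> D \<Longrightarrow> (H has_field_derivative Complex (\<phi> z + Im z * V z) (- Im z * U z)) (at z)"
proof -
  obtain Ua Ub Va Vb where
    *: "continuous_on D Ua" "continuous_on D Ub" "continuous_on D Va" "continuous_on D Vb"
    and **: "\<And>z. z \<in> D \<Longrightarrow> (U has_derivative (\<lambda>h. Re h *\<^sub>R Ua z + Im h *\<^sub>R Ub z)) (at z)"
      "\<And>z. z \<in> D \<Longrightarrow> (V has_derivative (\<lambda>h. Re h *\<^sub>R Va z + Im h *\<^sub>R Vb z)) (at z)"
      "\<And>z. z \<in> D \<Longrightarrow> Ub z = - Va z" "\<And>z. z \<in> D \<Longrightarrow> Im z *\<^sub>R (Ua z - Vb z) = 2 *\<^sub>R V z"
    using assms(3) unfolding stem_system_def by blast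
  obtain \<phi> where \<phi>: "\<And>z. z \<in> D \<Longrightarrow> (\<phi> has_derivative (\<lambda>h. Re h * (- U z) + Im h * V z)) (at z)"
  proof (rule closed_form_potential[OF D, of "\<lambda>z. - Ua z" "Va" Vb "\<lambda>z. - U z" V])
    show "continuous_on D (\<lambda>z. - Ua z)" "continuous_on D Va" "continuous_on D Vb"
      using * by (auto intro: continuous_intros)
    show "((\<lambda>z. - U z) has_derivative (\<lambda>h. Re h * - Ua z + Im h * Va z)) (at z)" if "z \<in> D" for z
      using has_derivative_minus[OF **(1)[OF that]] **(3)[OF that] by (simp add: algebra_simps)
    show "(V has_derivative (\<lambda>h. Re h * Va z + Im h * Vb z)) (at z)" if "z \<in> D" for z
      using **(2)[OF that] by simp
  qed blast
  define G where "G z = Complex (\<phi> z + Im z * V z) (- Im z * U z)" for z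
  have Im_der: "(Im has_derivative Im) (at z)" for z
    by (simp add: bounded_linear_Im bounded_linear_imp_has_derivative)
  have "(G has_field_derivative Complex (Im z * Va z - U z) (- Im z * Ua z)) (at z)" if z: "z \<in> D" for z
  proof -
    have 1: "((\<lambda>z. \<phi> z + Im z * V z) has_derivative
        (\<lambda>h. Re h * (- U z) + Im h * V z + (Im z * (Re h * Va z + Im h * Vb z) + Im h * V z))) (at z)"
      using **(2)[OF z] by (intro has_derivative_add \<phi>[OF z] has_derivative_mult Im_der) simp
    have 2: "((\<lambda>z. - Im z * U z) has_derivative
        (\<lambda>h. - Im z * (Re h * Ua z + Im h * Ub z) + (- Im h) * U z)) (at z)"
      using **(1)[OF z] by (intro has_derivative_mult has_derivative_minus Im_der) simp
    have "(G has_derivative (\<lambda>h. complex_of_real (Re h * (- U z) + Im h * V z + (Im z * (Re h * Va z + Im h * Vb z) + Im h * V z))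
      + \<i> * complex_of_real (- Im z * (Re h * Ua z + Im h * Ub z) + (- Im h) * U z))) (at z)"
      unfolding G_def Complex_eq
      by (intro has_derivative_add has_derivative_mult_right has_derivative_of_real 1 2)
    also have "(\<lambda>h. complex_of_real (Re h * (- U z) + Im h * V z + (Im z * (Re h * Va z + Im h * Vb z) + Im h * V z))
      + \<i> * complex_of_real (- Im z * (Re h * Ua z + Im h * Ub z) + (- Im h) * U z))
      = (*) (Complex (Im z * Va z - U z) (- Im z * Ua z))"
    proof
      fix h
      \<comment> \<open>This is one Cauchy-Riemann equation of \<open>G\<close>; the other one is
        \<open>Ub z = - Va z\<close>.\<close>
      have "Im z * Ua z = 2 * V z + Im z * Vb z" using **(4)[OF z] by (simp add: algebra_simps)
      then have "Im h * (Im z * Ua z) = Im h * (2 * V z + Im z * Vb z)" by simp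
      with **(3)[OF z] show "complex_of_real (Re h * (- U z) + Im h * V z + (Im z * (Re h * Va z + Im h * Vb z) + Im h * V z))
        + \<i> * complex_of_real (- Im z * (Re h * Ua z + Im h * Ub z) + (- Im h) * U z)
        = Complex (Im z * Va z - U z) (- Im z * Ua z) * h"
        by (simp add: complex_eq_iff algebra_simps)
    qed
    finally show ?thesis unfolding has_field_derivative_def .
  qed
  then have "G holomorphic_on D" using D(1) by (auto simp: holomorphic_on_open)
  then obtain K where "\<And>z. z \<in> D \<Longrightarrow> (K has_field_derivative G z) (at z within D)"
    by (rule holomorphic_convex_primitive'[OF D(2,1)]) blast
  then have K: "\<And>z. z \<in> D \<Longrightarrow> (K has_field_derivative G z) (at z)"
    using D(1) by (simp add: at_within_open_NO_MATCH)
  \<comment> \<open>Both terms have the differential \<open>Im (G z * h)\<close>, so they differ by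
    a constant, which \<open>H\<close> removes.\<close>
  have "((\<lambda>z. Im (K z) - Im z * \<phi> z) has_derivative (\<lambda>h. 0)) (at z within D)" if z: "z \<in> D" for z
  proof -
    have "((\<lambda>z. Im (K z) - Im z * \<phi> z) has_derivative (\<lambda>h. Im (G z * h) -
        (Im z * (Re h * (- U z) + Im h * V z) + Im h * \<phi> z))) (at z)"
      using K[OF z] unfolding has_field_derivative_def
      by (intro has_derivative_diff has_derivative_mult \<phi>[OF z] Im_der bounded_linear.has_derivative[OF bounded_linear_Im])
    then show ?thesis by (auto intro!: has_derivative_at_withinI simp: G_def algebra_simps)
  qed
  from has_derivative_zero_constant[OF D(2) this]
  obtain k where k: "\<And>z. z \<in> D \<Longrightarrow> Im (K z) - Im z * \<phi> z = k" by blast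
  define H where "H z = K z - \<i> * complex_of_real k" for z
  have H: "(H has_field_derivative G z) (at z)" if "z \<in> D" for z
    unfolding H_def by (auto intro!: derivative_eq_intros K that)
  show ?thesis
  proof (rule that)
    show "H holomorphic_on D" using H D(1) by (auto simp: holomorphic_on_open)
    show "(\<phi> has_derivative (\<lambda>h. Im h * V z - Re h * U z)) (at z)" if "z \<in> D" for z
      using \<phi>[OF that] by (simp add: algebra_simps)
    show "Im (H z) = Im z * \<phi> z" if "z \<in> D" for z using k[OF that] by (simp add: H_def)
  qed (use H in \<open>auto simp: G_def\<close>)
qed

subsection \<open>Uniqueness and maximum principle for stem equations\<close>

text \<open>
  On the circle \<open>norm z = \<rho>\<close> the factor \<open>z / \<rho> - \<rho> / z\<close> equals \<open>2 i Im z / \<rho>\<close>, so that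
  \<open>h = (F - F 0) (z / \<rho> - \<rho> / z)\<close> has nonpositive real part there, while \<open>h 0 = 0\<close>.
\<close>

lemma holomorphic_constI_Im:
  assumes F: "F holomorphic_on ball 0 r" and r: "0 < r"
    and sgn: "\<And>z. z \<in> ball 0 r \<Longrightarrow> 0 \<le> Im z * Im (F z)"
    and F0: "Im (F 0) = 0" "deriv F 0 = 0"
    and z1: "z1 \<in> ball 0 r"
  shows "F z1 = F 0"
proof -
  \<comment> \<open>Dividing by \<open>z\<close> here absorbs the pole of \<open>\<rho> / z\<close>;
    the value \<open>deriv F 0 = 0\<close> at the origin is what gives
    \<open>h 0 = 0\<close>.\<close>
  define g where "g z = (if z = 0 then deriv F 0 else (F z - F 0) / (z - 0))" for z
  have g: "g holomorphic_on ball 0 r"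
    unfolding g_def by (rule pole_lemma_open[OF F open_ball])
  have g_mult: "z * g z = F z - F 0" for z by (simp add: g_def)
  obtain \<rho> where \<rho>: "norm z1 < \<rho>" "\<rho> < r" using z1 dense by auto
  then have \<rho>0: "0 < \<rho>" by (meson le_less_trans norm_ge_zero)
  define h where "h z = g z * (z\<^sup>2 / of_real \<rho> - of_real \<rho>)" for z
  have sub: "ball 0 \<rho> \<subseteq> ball 0 r" "cball (0::complex) \<rho> \<subseteq> ball 0 r" using \<rho> by auto
  have h: "h holomorphic_on ball 0 r"
    unfolding h_def using \<rho>0 by (intro holomorphic_intros g) auto
  have h0: "h 0 = 0" by (simp add: h_def g_def F0)
  have circle: "Re (h z) \<le> 0" if "norm z = \<rho>" for z
  proof -
    have "of_real \<rho> * of_real \<rho> = z * cnj z"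
      using complex_norm_square[of z] that by (simp add: power2_eq_square)
    then have "z\<^sup>2 / of_real \<rho> - of_real \<rho> = z * (z - cnj z) / of_real \<rho>"
      using \<rho>0 by (simp add: field_simps power2_eq_square)
    then have "h z = (F z - F 0) * (z - cnj z) / of_real \<rho>"
      unfolding h_def g_mult[symmetric] by simp
    then have "Re (h z) = - 2 * (Im z * Im (F z)) / \<rho>"
      using F0 by (simp add: complex_diff_cnj)
    moreover have "0 \<le> Im z * Im (F z)" using sgn[of z] that \<rho> by simp
    moreover have "- 2 * (Im z * Im (F z)) / \<rho> \<le> 0"
      by (rule divide_nonpos_pos) (use calculation \<rho>0 in auto)
    ultimately show ?thesis by simp
  qed
  \<comment> \<open>The sign passes from the circle to the disc by the maximum modulus principle for
    \<open>exp h\<close>, whose modulus is \<open>exp (Re h)\<close>.\<close>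
  have Re_h: "Re (h z) \<le> 0" if "z \<in> ball 0 \<rho>" for z
  proof -
    have "norm (exp (h z)) \<le> 1"
    proof (rule maximum_modulus_frontier[of "\<lambda>z. exp (h z)" "ball 0 \<rho>"])
      show "(\<lambda>z. exp (h z)) holomorphic_on interior (ball 0 \<rho>)"
        using h sub by (auto intro!: holomorphic_intros elim: holomorphic_on_subset)
      show "continuous_on (closure (ball 0 \<rho>)) (\<lambda>z. exp (h z))"
        using holomorphic_on_imp_continuous_on[OF h] sub \<rho>0
        by (auto intro!: continuous_intros elim: continuous_on_subset)
      show "norm (exp (h z)) \<le> 1" if "z \<in> frontier (ball 0 \<rho>)" for z
        using that circle \<rho>0 by simp
    qed (use that in auto)
    then show ?thesis by simp
  qed
  have ne: "1 - h z \<noteq> 0" if "z \<in> ball 0 \<rho>" for z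
    using Re_h[OF that] by (auto simp: complex_eq_iff)
  \<comment> \<open>Where \<open>Re h \<le> 0\<close> this function has modulus at most 1, and it
    takes the value 1 at the interior point 0.\<close>
  have "(\<lambda>z. 1 / (1 - h z)) constant_on ball 0 \<rho>"
  proof (rule maximum_modulus_principle[of _ _ "ball 0 \<rho>" 0])
    show "(\<lambda>z. 1 / (1 - h z)) holomorphic_on ball 0 \<rho>"
      using ne by (intro holomorphic_intros holomorphic_on_subset[OF h] sub) auto
    show "norm (1 / (1 - h z)) \<le> norm (1 / (1 - h 0))" if "z \<in> ball 0 \<rho>" for z
    proof -
      have "1 \<le> Re (1 - h z)" using Re_h[OF that] by simp
      also have "\<dots> \<le> norm (1 - h z)" by (rule complex_Re_le_cmod)
      finally show ?thesis by (auto simp: h0 norm_divide divide_le_eq_1)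
    qed
  qed (use \<rho>0 in auto)
  moreover have "z1 \<in> ball 0 \<rho>" "0 \<in> ball 0 \<rho>" using \<rho> \<rho>0 by auto
  ultimately have "1 / (1 - h z1) = 1 / (1 - h 0)" unfolding constant_on_def by metis
  then have "h z1 = 0" using h0 ne[OF \<open>z1 \<in> ball 0 \<rho>\<close>] by simp
  moreover have "z1\<^sup>2 / of_real \<rho> - of_real \<rho> \<noteq> 0"
  proof
    assume "z1\<^sup>2 / of_real \<rho> - of_real \<rho> = 0"
    then have "z1\<^sup>2 = (of_real \<rho>)\<^sup>2" using \<rho>0 by (simp add: field_simps power2_eq_square)
    then have "norm z1 = \<rho>" using \<rho>0 by (auto simp: power2_eq_iff)
    then show False using \<rho> by simp
  qed
  ultimately have "g z1 = 0" by (simp add: h_def)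
  then show ?thesis using g_mult[of z1] by simp
qed

text \<open>The identity theorem is applied to \<open>deriv H\<close>, whose parts are
  \<open>\<phi> + Im z * V\<close> and \<open>- Im z * U\<close>. That it is a real constant
  \<open>k\<close> kills \<open>U\<close> but leaves \<open>\<phi>\<close> and \<open>V\<close>
  mixed. Integrating once more, \<open>H w = k w + l\<close> with \<open>l\<close> real, so
  \<open>\<phi> = k\<close> off the real axis and \<open>V = 0\<close> there.\<close>

lemma stem_system_unique:
  fixes U V :: "complex \<Rightarrow> real"
  assumes D: "open D" "convex D" and sys: "stem_system D U V"
    and N: "open N" "N \<subseteq> D" "N \<noteq> {}" "\<And>z. z \<in> N \<Longrightarrow> U z = 0 \<and> V z = 0"
    and z: "z \<in> D" "Im z \<noteq> 0"
  shows "U z = 0 \<and> V z = 0"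
proof -
  obtain \<phi> H where H: "H holomorphic_on D"
    and \<phi>: "\<And>z. z \<in> D \<Longrightarrow> (\<phi> has_derivative (\<lambda>h. Im h * V z - Re h * U z)) (at z)"
    and Im_H: "\<And>z. z \<in> D \<Longrightarrow> Im (H z) = Im z * \<phi> z"
    and dH: "\<And>z. z \<in> D \<Longrightarrow> (H has_field_derivative Complex (\<phi> z + Im z * V z) (- Im z * U z)) (at z)"
    by (rule stem_system_potential[OF D sys]) (rule that)
  obtain z1 e where e: "0 < e" "ball z1 e \<subseteq> N" using N by (meson ex_in_conv openE)
  then have z1: "z1 \<in> D" using N(2) by (meson centre_in_ball subsetD)
  have "(\<phi> has_derivative (\<lambda>h. 0)) (at w within ball z1 e)" if "w \<in> ball z1 e" for w
  proof -
    have "w \<in> N" "w \<in> D" using that e(2) N(2) by blast+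
    then have "(\<phi> has_derivative (\<lambda>h. 0)) (at w)" using \<phi>[of w] N(4)[of w] by simp
    then show ?thesis by (rule has_derivative_at_withinI)
  qed
  from has_derivative_zero_constant[OF convex_ball this]
  obtain k where k: "\<And>w. w \<in> ball z1 e \<Longrightarrow> \<phi> w = k" by blast
  have dH': "deriv H w = Complex (\<phi> w + Im w * V w) (- Im w * U w)" if "w \<in> D" for w
    by (rule DERIV_imp_deriv[OF dH[OF that]])
  have derivH: "deriv H w = of_real k" if "w \<in> D" for w
  proof -
    have "deriv H w - of_real k = 0"
    proof (rule analytic_continuation[of "\<lambda>w. deriv H w - of_real k" D "ball z1 e" z1])
      show "(\<lambda>w. deriv H w - of_real k) holomorphic_on D"
        by (intro holomorphic_intros H D)
      show "connected D" using D by (simp add: convex_connected)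
      show "ball z1 e \<subseteq> D" using e N by blast
      show "z1 islimpt ball z1 e" using e by (simp add: islimpt_ball)
      show "deriv H w - of_real k = 0" if "w \<in> ball z1 e" for w
      proof -
        have "w \<in> D" "U w = 0" "V w = 0" using that e N by blast+
        then show ?thesis using k[OF that] by (simp add: dH' complex_eq_iff)
      qed
    qed (use D z1 that in auto)
    then show ?thesis by simp
  qed
  have U: "Im w * U w = 0" and V: "\<phi> w + Im w * V w = k" if "w \<in> D" for w
    using dH'[OF that] derivH[OF that] by (auto simp: complex_eq_iff)
  have "((\<lambda>w. H w - of_real k * w) has_derivative (\<lambda>h. 0)) (at w within D)" if "w \<in> D" for w
  proof -
    have "(H has_field_derivative of_real k) (at w)"
      using dH[OF that] derivH[OF that] dH'[OF that] by simp
    then have "((\<lambda>w. H w - of_real k * w) has_field_derivative 0) (at w)"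
      by (auto intro!: derivative_eq_intros)
    then have "((\<lambda>w. H w - of_real k * w) has_derivative (*) 0) (at w)"
      by (simp only: has_field_derivative_def)
    then show ?thesis by (subst lambda_zero) (rule has_derivative_at_withinI)
  qed
  from has_derivative_zero_constant[OF D(2) this]
  obtain l where l: "\<And>w. w \<in> D \<Longrightarrow> H w - of_real k * w = l" by blast
  have "Im l = 0" using l[OF z1] Im_H[OF z1] k[of z1] e(1) by (auto simp: complex_eq_iff)
  then have "Im z * \<phi> z = Im z * k" using l[OF z(1)] Im_H[OF z(1)] by (auto simp: complex_eq_iff)
  then have "\<phi> z = k" using z(2) by simp
  then show ?thesis using U[OF z(1)] V[OF z(1)] z(2) by simp
qed

text \<open>On a sphere about a real point the parts \<open>J v\<close> average out, so the mean is
  the \<open>u\<close>-part alone, here \<open>U\<close>. Up to sign, \<open>Im z * U z\<close> is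
  the imaginary part of \<open>deriv H\<close>, to which \<open>holomorphic_constI_Im\<close>
  applies.\<close>

lemma stem_system_max_real:
  fixes U V :: "complex \<Rightarrow> real"
  assumes r: "0 < r" and sys: "stem_system (ball (of_real a0) r) U V"
    and le: "\<And>z. z \<in> ball (of_real a0) r \<Longrightarrow> U z \<le> 0" and eq: "U (of_real a0) = 0"
    and z: "z \<in> ball (of_real a0) r" "Im z \<noteq> 0"
  shows "U z = 0"
proof -
  let ?D = "ball (of_real a0 :: complex) r"
  obtain \<phi> H where H: "H holomorphic_on ?D"
    and \<phi>: "\<And>z. z \<in> ?D \<Longrightarrow> (\<phi> has_derivative (\<lambda>h. Im h * V z - Re h * U z)) (at z)"
    and "\<And>z. z \<in> ?D \<Longrightarrow> Im (H z) = Im z * \<phi> z"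
    and dH: "\<And>z. z \<in> ?D \<Longrightarrow> (H has_field_derivative Complex (\<phi> z + Im z * V z) (- Im z * U z)) (at z)"
    by (rule stem_system_potential[OF open_ball convex_ball sys]) (rule that)
  have dH': "deriv H w = Complex (\<phi> w + Im w * V w) (- Im w * U w)" if "w \<in> ?D" for w
    by (rule DERIV_imp_deriv[OF dH[OF that]])
  define F where "F \<zeta> = deriv H (of_real a0 + \<zeta>)" for \<zeta>
  have mem: "of_real a0 + \<zeta> \<in> ?D" if "\<zeta> \<in> ball 0 r" for \<zeta> using that by (simp add: dist_norm)
  have F: "F holomorphic_on ball 0 r"
    unfolding F_def
    by (rule holomorphic_on_compose_gen[OF _ holomorphic_deriv[OF H open_ball], unfolded o_def])
       (auto intro!: holomorphic_intros dest: mem)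
  have Im_F: "Im (F \<zeta>) = - Im \<zeta> * U (of_real a0 + \<zeta>)" if "\<zeta> \<in> ball 0 r" for \<zeta>
    using dH'[OF mem[OF that]] by (simp add: F_def)
  \<comment> \<open>Along the real axis \<open>F\<close> is the real function \<open>\<phi>\<close>,
    whose derivative at \<open>a0\<close> is \<open>- U a0 = 0\<close>.\<close>
  have "deriv F 0 = 0"
  proof -
    have 0: "0 \<in> ball 0 r" using r by simp
    have "(F has_field_derivative deriv F 0) (at 0)"
      using F 0 by (simp add: holomorphic_derivI)
    then have "((F \<circ> of_real) has_vector_derivative 1 * deriv F 0) (at 0)"
      by (intro field_vector_diff_chain_at) (auto intro!: derivative_eq_intros)
    moreover have "((F \<circ> of_real) has_vector_derivative 0) (at 0)"
    proof (rule has_vector_derivative_transform_within_open[where S = "{-r<..<r}"])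
      have 1: "((\<lambda>t. of_real a0 + of_real t) has_derivative (\<lambda>h. of_real h)) (at (0::real))"
        by (auto intro!: derivative_eq_intros)
      have "((\<lambda>t. \<phi> (of_real a0 + of_real t)) has_derivative
          (\<lambda>h. Im (of_real h) * V (of_real a0) - Re (of_real h) * U (of_real a0))) (at (0::real))"
        by (rule has_derivative_compose[OF 1]) (use \<phi>[OF mem[OF 0]] in simp)
      then have "((\<lambda>t. complex_of_real (\<phi> (of_real a0 + of_real t))) has_derivative (\<lambda>h. of_real 0)) (at (0::real))"
        using eq by (intro has_derivative_of_real) simp
      then show "((\<lambda>t. complex_of_real (\<phi> (of_real a0 + of_real t))) has_vector_derivative 0) (at (0::real))"
        by (simp add: has_vector_derivative_def)
      fix t :: real assume "t \<in> {-r<..<r}"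
      then have "complex_of_real t \<in> ball 0 r" by (simp add: abs_less_iff)
      then show "complex_of_real (\<phi> (of_real a0 + of_real t)) = (F \<circ> of_real) t"
        using dH'[OF mem] by (simp add: F_def complex_eq_iff)
    qed (use r in auto)
    ultimately show ?thesis by (metis mult_1 vector_derivative_unique_at)
  qed
  have zz: "z - of_real a0 \<in> ball 0 r" using z by (simp add: dist_norm norm_minus_commute)
  have "F (z - of_real a0) = F 0"
  proof (rule holomorphic_constI_Im[OF F r _ _ \<open>deriv F 0 = 0\<close> zz])
    show "0 \<le> Im \<zeta> * Im (F \<zeta>)" if "\<zeta> \<in> ball 0 r" for \<zeta>
    proof -
      have "Im \<zeta> * Im (F \<zeta>) = (Im \<zeta>)\<^sup>2 * (- U (of_real a0 + \<zeta>))"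
        using Im_F[OF that] by (simp add: power2_eq_square)
      also have "\<dots> \<ge> 0" using le[OF mem[OF that]] by (intro mult_nonneg_nonneg) auto
      finally show ?thesis .
    qed
    show "Im (F 0) = 0" using Im_F[of 0] r by simp
  qed
  then have "Im (F (z - of_real a0)) = 0" using Im_F[of 0] r by simp
  then show ?thesis using Im_F[OF zz] z(2) by simp
qed

text \<open>
  \<open>U1 + \<tau> V2\<close> is the average of a function at two points at distance \<open>s\<close> from the axis through the
  point \<open>a0 + b0 I\<close> parallel to the real one, and \<open>\<tau>\<close> is the cosine of the angle that their
  imaginary parts make with \<open>I\<close>. The integral over \<open>b0 - s \<le> b \<le> b0 + s\<close> of \<open>- b (U1 + \<tau> V2)\<close>
  is, up to a factor, \<open>s\<close> times the spherical mean around that point. Its primitive in \<open>b\<close>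
  is \<open>X a s\<close> below, and its value is the imaginary part of a holomorphic function of \<open>a + i s\<close>.
\<close>

lemma stem_system_max_nonreal:
  fixes U1 V1 U2 V2 :: "complex \<Rightarrow> real"
  defines "\<tau> \<equiv> \<lambda>b0 s b. (b\<^sup>2 + b0\<^sup>2 - s\<^sup>2) / (2 * b0 * b)"
  assumes r: "0 < r" "r \<le> Im z0"
    and sys: "stem_system (ball z0 r) U1 V1" "stem_system (ball z0 r) U2 V2"
    and le: "\<And>z s. \<bar>Im z - Im z0\<bar> \<le> s \<Longrightarrow> (Re z - Re z0)\<^sup>2 + s\<^sup>2 < r\<^sup>2 \<Longrightarrow>
      U1 z + \<tau> (Im z0) s (Im z) * V2 z \<le> 0"
    and eq: "U1 z0 + V2 z0 = 0"
    and z: "z \<in> ball z0 r"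
  shows "U1 z = 0 \<and> V2 z = 0"
proof -
  let ?D = "ball z0 r"
  define b0 where "b0 = Im z0"
  have b0: "0 < b0" using r by (simp add: b0_def)
  have mem_D: "w \<in> ?D \<longleftrightarrow> (Re w - Re z0)\<^sup>2 + (Im w - b0)\<^sup>2 < r\<^sup>2" for w
  proof -
    have "w \<in> ?D \<longleftrightarrow> norm (w - z0) < r" by (simp add: dist_norm norm_minus_commute)
    also have "\<dots> \<longleftrightarrow> (norm (w - z0))\<^sup>2 < r\<^sup>2" using r(1) by (auto intro: power2_less_imp_less power_strict_mono)
    finally show ?thesis by (simp add: cmod_power2 b0_def)
  qed
  have pos_D: "0 < Im w" if "w \<in> ?D" for w
  proof -
    have "\<bar>Im (w - z0)\<bar> \<le> norm (w - z0)" by (rule abs_Im_le_cmod)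
    also have "\<dots> < r" using that by (simp add: dist_norm norm_minus_commute)
    finally show ?thesis using r by simp
  qed
  obtain \<phi>1 H1 where H1: "H1 holomorphic_on ?D"
    and "\<And>z. z \<in> ?D \<Longrightarrow> (\<phi>1 has_derivative (\<lambda>h. Im h * V1 z - Re h * U1 z)) (at z)"
    and "\<And>z. z \<in> ?D \<Longrightarrow> Im (H1 z) = Im z * \<phi>1 z"
    and dH1: "\<And>z. z \<in> ?D \<Longrightarrow> (H1 has_field_derivative Complex (\<phi>1 z + Im z * V1 z) (- Im z * U1 z)) (at z)"
    by (rule stem_system_potential[OF open_ball convex_ball sys(1)]) (rule that)
  obtain \<phi>2 H2 where H2: "H2 holomorphic_on ?D"
    and \<phi>2: "\<And>z. z \<in> ?D \<Longrightarrow> (\<phi>2 has_derivative (\<lambda>h. Im h * V2 z - Re h * U2 z)) (at z)"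
    and Im_H2: "\<And>z. z \<in> ?D \<Longrightarrow> Im (H2 z) = Im z * \<phi>2 z"
    and dH2: "\<And>z. z \<in> ?D \<Longrightarrow> (H2 has_field_derivative Complex (\<phi>2 z + Im z * V2 z) (- Im z * U2 z)) (at z)"
    by (rule stem_system_potential[OF open_ball convex_ball sys(2)]) (rule that)
  obtain K2 where "\<And>z. z \<in> ?D \<Longrightarrow> (K2 has_field_derivative H2 z) (at z within ?D)"
    by (rule holomorphic_convex_primitive'[OF convex_ball open_ball H2]) blast
  then have K2: "\<And>z. z \<in> ?D \<Longrightarrow> (K2 has_field_derivative H2 z) (at z)"
    by (simp add: at_within_open_NO_MATCH)
  \<comment> \<open>At the end points \<open>b = b0 + s\<close> and \<open>b = b0 - s\<close> one
    has \<open>\<tau> b0 s b = 1\<close>, so \<open>s\<close> drops out of \<open>X\<close> below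
    and the real part of this holomorphic function remains. The term
    \<open>K2 w / of_real b0\<close> cancels what the derivative of the quadratic factor of
    \<open>\<phi>2\<close> contributes to the derivative of \<open>X\<close>.\<close>
  define A where "A w = - H1 w + \<i> * H2 w - K2 w / of_real b0" for w
  define A' where "A' w = - Complex (\<phi>1 w + Im w * V1 w) (- Im w * U1 w)
     + \<i> * Complex (\<phi>2 w + Im w * V2 w) (- Im w * U2 w) - H2 w / of_real b0" for w
  have dA: "(A has_field_derivative A' w) (at w)" if "w \<in> ?D" for w
    unfolding A_def A'_def using b0
    by (intro DERIV_diff DERIV_add DERIV_minus DERIV_cmult dH1 dH2 DERIV_cdivide K2 that)
  \<comment> \<open>Reflection in the line \<open>Im w = b0\<close> makes the difference of
    \<open>Re A\<close> at the heights \<open>b0 + s\<close> and \<open>b0 - s\<close> the imaginary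
    part of a function holomorphic in \<open>\<zeta>\<close>, where
    \<open>s = Im \<zeta>\<close>.\<close>
  define F where "F \<zeta> = \<i> * (A (z0 + \<zeta>) - cnj (A (z0 + cnj \<zeta>)))" for \<zeta>
  have mem: "z0 + \<zeta> \<in> ?D" "z0 + cnj \<zeta> \<in> ?D" if "\<zeta> \<in> ball 0 r" for \<zeta>
    using that by (simp_all add: dist_norm)
  have dF: "(F has_field_derivative \<i> * (A' (z0 + \<zeta>) - cnj (A' (z0 + cnj \<zeta>)))) (at \<zeta>)"
    if "\<zeta> \<in> ball 0 r" for \<zeta>
  proof -
    have 1: "((\<lambda>\<zeta>. A (z0 + \<zeta>)) has_field_derivative A' (z0 + \<zeta>)) (at \<zeta>)"
      using dA[OF mem(1)[OF that]] DERIV_shift[of A _ \<zeta> z0] by (simp add: add.commute)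
    have 2: "((\<lambda>\<zeta>. A (z0 + \<zeta>)) has_field_derivative A' (z0 + cnj \<zeta>)) (at (cnj \<zeta>))"
      using dA[OF mem(2)[OF that]] DERIV_shift[of A _ "cnj \<zeta>" z0] by (simp add: add.commute)
    show ?thesis
      unfolding F_def
      using has_field_derivative_cnj_cnj[OF 2] by (intro DERIV_cmult DERIV_diff 1) (simp add: o_def)
  qed
  have F: "F holomorphic_on ball 0 r" unfolding holomorphic_on_open[OF open_ball] using dF by blast
  define X where "X a s b = - Re (H1 (Complex a b)) - (b\<^sup>2 + b0\<^sup>2 - s\<^sup>2) / (2 * b0) * \<phi>2 (Complex a b)
     - Re (K2 (Complex a b)) / b0" for a s b
  have X_eq: "X a s b = Re (A (Complex a b))" if "Complex a b \<in> ?D" "b = b0 + s \<or> b = b0 - s" for a s b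
  proof -
    have "(b\<^sup>2 + b0\<^sup>2 - s\<^sup>2) / (2 * b0) = b"
      using that(2) b0 by (auto simp: field_simps power2_eq_square)
    then show ?thesis using Im_H2[OF that(1)] by (simp add: X_def A_def)
  qed
  have dX: "(X a s has_real_derivative - b * (U1 (Complex a b) + \<tau> b0 s b * V2 (Complex a b))) (at b)"
    if w: "Complex a b \<in> ?D" for a s b
  proof -
    have b: "0 < b" using pos_D[OF w] by simp
    have c: "(Complex a has_vector_derivative \<i>) (at b)"
      unfolding Complex_eq by (auto intro!: derivative_eq_intros)
    have re: "((\<lambda>b. Re (f (Complex a b))) has_real_derivative - Im d) (at b)"
      if "(f has_field_derivative d) (at (Complex a b))" for f d
    proof -
      have "((f \<circ> Complex a) has_vector_derivative \<i> * d) (at b)"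
        by (rule field_vector_diff_chain_at[OF c that])
      from bounded_linear.has_vector_derivative[OF bounded_linear_Re this]
      show ?thesis by (simp add: has_real_derivative_iff_has_vector_derivative o_def)
    qed
    have ph: "((\<lambda>b. \<phi>2 (Complex a b)) has_real_derivative V2 (Complex a b)) (at b)"
      using has_derivative_compose[OF c[unfolded has_vector_derivative_def] \<phi>2[OF w]]
      by (simp add: has_field_derivative_def mult.commute[of _ "V2 _"])
    have "(X a s has_real_derivative
      - (- Im (Complex (\<phi>1 (Complex a b) + b * V1 (Complex a b)) (- b * U1 (Complex a b))))
      - (2 * b / (2 * b0) * \<phi>2 (Complex a b) + V2 (Complex a b) * ((b\<^sup>2 + b0\<^sup>2 - s\<^sup>2) / (2 * b0)))
      - - Im (H2 (Complex a b)) / b0) (at b)"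
      unfolding X_def
      apply (intro DERIV_diff DERIV_minus DERIV_cdivide DERIV_mult re K2[OF w] ph)
      using dH1[OF w] apply simp
      using b0 by (auto intro!: derivative_eq_intros)
    moreover have "- (- Im (Complex (\<phi>1 (Complex a b) + b * V1 (Complex a b)) (- b * U1 (Complex a b))))
      - (2 * b / (2 * b0) * \<phi>2 (Complex a b) + V2 (Complex a b) * ((b\<^sup>2 + b0\<^sup>2 - s\<^sup>2) / (2 * b0)))
      - - Im (H2 (Complex a b)) / b0 = - b * (U1 (Complex a b) + \<tau> b0 s b * V2 (Complex a b))"
      using b b0 Im_H2[OF w] by (simp add: \<tau>_def field_simps)
    ultimately show ?thesis by simp
  qed
  have inD: "Complex a b \<in> ?D" if "(a - Re z0)\<^sup>2 + s\<^sup>2 < r\<^sup>2" "b0 - s \<le> b" "b \<le> b0 + s" for a b s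
  proof -
    have "\<bar>b - b0\<bar> \<le> \<bar>s\<bar>" using that by auto
    then have "(b - b0)\<^sup>2 \<le> s\<^sup>2" by (simp add: abs_le_square_iff)
    then show ?thesis using that(1) unfolding mem_D by simp
  qed
  \<comment> \<open>Here \<open>le\<close> becomes a sign condition on \<open>Im F\<close>: the
    integrand has constant sign. Monotonicity also recovers the integrand once the integral is known
    to vanish.\<close>
  have X_mono: "X a s b \<le> X a s b'"
    if "(a - Re z0)\<^sup>2 + s\<^sup>2 < r\<^sup>2" "b0 - s \<le> b" "b \<le> b'" "b' \<le> b0 + s" for a s b b'
  proof (rule DERIV_nonneg_imp_nondecreasing[OF that(3)])
    fix x assume x: "b \<le> x" "x \<le> b'"
    then have w: "Complex a x \<in> ?D" using inD that by force
    have "U1 (Complex a x) + \<tau> b0 s x * V2 (Complex a x) \<le> 0"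
      using le[of "Complex a x" s] that x by (simp add: b0_def)
    then have "0 \<le> - x * (U1 (Complex a x) + \<tau> b0 s x * V2 (Complex a x))"
      using pos_D[OF w] by (simp add: mult_nonneg_nonpos)
    with dX[OF w, of s] show "\<exists>y. (X a s has_real_derivative y) (at x) \<and> 0 \<le> y" by blast
  qed
  have Im_F: "Im (F \<zeta>) = X (Re z0 + Re \<zeta>) s (b0 + s) - X (Re z0 + Re \<zeta>) s (b0 - s)"
    if "\<zeta> \<in> ball 0 r" "s = Im \<zeta>" for \<zeta> s
  proof -
    have 1: "z0 + \<zeta> = Complex (Re z0 + Re \<zeta>) (b0 + s)" "z0 + cnj \<zeta> = Complex (Re z0 + Re \<zeta>) (b0 - s)"
      using that by (simp_all add: complex_eq_iff b0_def)
    then show ?thesis using mem[OF that(1)] by (simp add: F_def X_eq)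
  qed
  have in0: "(Re z0 + Re \<zeta> - Re z0)\<^sup>2 + (Im \<zeta>)\<^sup>2 < r\<^sup>2" if "\<zeta> \<in> ball 0 r" for \<zeta>
    using mem(1)[OF that] unfolding mem_D by (simp add: b0_def)
  have Im_F_nonneg: "0 \<le> Im (F \<zeta>)" if "\<zeta> \<in> ball 0 r" "0 \<le> Im \<zeta>" for \<zeta>
    using Im_F[OF that(1) refl] X_mono[OF in0[OF that(1)], of "b0 - Im \<zeta>" "b0 + Im \<zeta>"] that(2) by simp
  have Im_F_cnj: "Im (F (cnj \<zeta>)) = - Im (F \<zeta>)" for \<zeta> by (simp add: F_def)
  \<comment> \<open>This derivative is \<open>- 2 * b0\<close> times the value
    \<open>U1 z0 + V2 z0\<close> at the common centre of the spheres, which the mean approaches as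
    the radius shrinks.\<close>
  have "deriv F 0 = 0"
  proof -
    have "deriv F 0 = \<i> * (A' z0 - cnj (A' z0))"
      using DERIV_imp_deriv[OF dF[of 0]] r by simp
    moreover have "Im (A' z0) = b0 * (U1 z0 + V2 z0)"
      using b0 r(1) Im_H2[of z0] by (simp add: A'_def b0_def field_simps)
    ultimately show ?thesis using eq by (simp add: complex_diff_cnj)
  qed
  have const: "Im (F \<zeta>) = 0" if "\<zeta> \<in> ball 0 r" for \<zeta>
  proof -
    have "Im (F 0) = 0" using Im_F_cnj[of 0] by simp
    moreover have "F \<zeta> = F 0"
    proof (rule holomorphic_constI_Im[OF F r(1) _ \<open>Im (F 0) = 0\<close> \<open>deriv F 0 = 0\<close> that])
      fix w :: complex assume w: "w \<in> ball 0 r"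
      show "0 \<le> Im w * Im (F w)"
      proof (cases "0 \<le> Im w")
        case True then show ?thesis using Im_F_nonneg[OF w] by simp
      next
        case False
        then have "0 \<le> Im (F (cnj w))" using w by (intro Im_F_nonneg) auto
        then show ?thesis using False Im_F_cnj[of w] by (simp add: mult_nonpos_nonpos)
      qed
    qed
    ultimately show ?thesis by simp
  qed
  define a b where "a = Re z" and "b = Im z"
  have zab: "z = Complex a b" by (simp add: a_def b_def)
  have b: "0 < b" using pos_D[OF z] by (simp add: b_def)
  \<comment> \<open>The monotone function \<open>X a s\<close> has equal end values, so it is
    constant. The strict inequality \<open>\<bar>b - b0\<bar> < s\<close> puts \<open>b\<close> in
    the interior, where the derivative must vanish.\<close>
  have zero: "U1 z + \<tau> b0 s b * V2 z = 0" if s: "\<bar>b - b0\<bar> < s" "(a - Re z0)\<^sup>2 + s\<^sup>2 < r\<^sup>2" for s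
  proof -
    have "Complex (a - Re z0) s \<in> ball 0 r"
      using s(2) mem_D[of "z0 + Complex (a - Re z0) s"] by (simp add: dist_norm b0_def)
    from const[OF this] Im_F[OF this refl] have X0: "X a s (b0 + s) = X a s (b0 - s)" by simp
    have Xc: "X a s b = X a s y" if "\<bar>b - y\<bar> < s - \<bar>b - b0\<bar>" for y
    proof -
      have y: "b0 - s \<le> y" "y \<le> b0 + s" using that by linarith+
      have "X a s y = X a s (b0 - s)"
        using X_mono[OF s(2), of "b0 - s" y] X_mono[OF s(2), of y "b0 + s"] X0 y by linarith
      moreover have "X a s b = X a s (b0 - s)"
        using X_mono[OF s(2), of "b0 - s" b] X_mono[OF s(2), of b "b0 + s"] X0 s(1) by linarith
      ultimately show ?thesis by simp
    qed
    have "- b * (U1 z + \<tau> b0 s b * V2 z) = 0"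
      using DERIV_local_const[OF dX[of a b s], of "s - \<bar>b - b0\<bar>"] z Xc s(1) by (simp add: zab)
    then show ?thesis using b by simp
  qed
  have "(a - Re z0)\<^sup>2 + (b - b0)\<^sup>2 < r\<^sup>2" using z unfolding mem_D by (simp add: a_def b_def)
  then have "\<bar>b - b0\<bar> < sqrt (r\<^sup>2 - (a - Re z0)\<^sup>2)"
    by (simp add: real_less_rsqrt)
  \<comment> \<open>For fixed \<open>z\<close> the cosine varies with \<open>s\<close>, so two radii
    give two independent equations for \<open>U1 z\<close> and \<open>V2 z\<close>.\<close>
  then obtain s1 where s1: "\<bar>b - b0\<bar> < s1" "s1 < sqrt (r\<^sup>2 - (a - Re z0)\<^sup>2)" using dense by blast
  then obtain s2 where s2: "s1 < s2" "s2 < sqrt (r\<^sup>2 - (a - Re z0)\<^sup>2)" using dense by blast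
  have lt: "(a - Re z0)\<^sup>2 + s\<^sup>2 < r\<^sup>2" if "0 < s" "s < sqrt (r\<^sup>2 - (a - Re z0)\<^sup>2)" for s
  proof -
    have "s\<^sup>2 < r\<^sup>2 - (a - Re z0)\<^sup>2" using that real_sqrt_less_iff[of "s\<^sup>2"] by fastforce
    then show ?thesis by simp
  qed
  have e1: "U1 z + \<tau> b0 s1 b * V2 z = 0" by (rule zero) (use s1 s2 in \<open>auto intro: lt\<close>)
  have e2: "U1 z + \<tau> b0 s2 b * V2 z = 0" by (rule zero) (use s1 s2 in \<open>auto intro: lt\<close>)
  have "(\<tau> b0 s1 b - \<tau> b0 s2 b) * V2 z = 0" using e1 e2 unfolding left_diff_distrib by linarith
  moreover have "\<tau> b0 s1 b - \<tau> b0 s2 b = (s2\<^sup>2 - s1\<^sup>2) / (2 * b0 * b)"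
    by (simp add: \<tau>_def flip: diff_divide_distrib)
  moreover have "s1\<^sup>2 < s2\<^sup>2" using s1 s2 by (intro power_strict_mono) auto
  ultimately have "V2 z = 0" using b b0 by simp
  then show ?thesis using e1 by simp
qed

subsection \<open>Octonion arithmetic\<close>

lemma UNIV_8: "(UNIV::8 set) = {0,1,2,3,4,5,6,7}"
proof -
  have "card {0,1,2,3,4,5,6,7::8} = CARD(8)" by simp
  then show ?thesis by (metis card_subset_eq finite subset_UNIV)
qed

lemma sum_8: "(\<Sum>l\<in>(UNIV::8 set). g l) = g 0 + g 1 + g 2 + g 3 + g 4 + g 5 + g 6 + g 7"
  unfolding UNIV_8 by (simp add: add.assoc)

lemma forall_8: "(\<forall>l::8. P l) \<longleftrightarrow> P 0 \<and> P 1 \<and> P 2 \<and> P 3 \<and> P 4 \<and> P 5 \<and> P 6 \<and> P 7"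
  by (metis UNIV_8 UNIV_I empty_iff insert_iff)

lemmas less_8 = less_bit0_def less_eq_bit0_def bit0.Rep_numeral bit0.Rep_0 bit0.Rep_1

lemma one_le_8: "(1::8) \<le> n \<longleftrightarrow> n \<noteq> 0"
  by (rule spec[of _ n]) (simp add: forall_8 less_8)

lemma Collect_one_le_8: "{n::8. 1 \<le> n} = {1,2,3,4,5,6,7}"
  using UNIV_8 by (auto simp: one_le_8)

lemma greaterThan_8:
  "{1<..} = {2,3,4,5,6,7::8}" "{2<..} = {3,4,5,6,7::8}" "{3<..} = {4,5,6,7::8}"
  "{4<..} = {5,6,7::8}" "{5<..} = {6,7::8}" "{6<..} = {7::8}" "{7<..} = ({}::8 set)"
  by (simp_all add: set_eq_iff forall_8 less_8)

lemma oct_e_nth: "oct_e l $ k = (if k = l then 1 else 0)"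
  by (simp add: oct_e_def axis_def)

lemma oct_basis_mult_nth:
  "oct_basis_mult l m $ k =
    (if l = 0 then (if k = m then 1 else 0) else if m = 0 then (if k = l then 1 else 0)
     else if l = m then (if k = 0 then -1 else 0) else if k = 0 then 0 else oct_eps l m k)"
  by (simp add: oct_basis_mult_def oct_e_nth if_distrib [of "(*) _"] one_le_8 cong: if_cong)

text \<open>Each imaginary index lies in three of the seven triples. With the last index fixed, only
  pairs of numerals are compared, so the simplifier can expand products in coordinates.\<close>

lemma oct_eps_fixed:
  "oct_eps l m 1 = (if (l,m) \<in> {(2,3), (4,5), (7,6)} then 1 else if (m,l) \<in> {(2,3), (4,5), (7,6)} then -1 else 0)"
  "oct_eps l m 2 = (if (l,m) \<in> {(3,1), (4,6), (5,7)} then 1 else if (m,l) \<in> {(3,1), (4,6), (5,7)} then -1 else 0)"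
  "oct_eps l m 3 = (if (l,m) \<in> {(1,2), (4,7), (6,5)} then 1 else if (m,l) \<in> {(1,2), (4,7), (6,5)} then -1 else 0)"
  "oct_eps l m 4 = (if (l,m) \<in> {(5,1), (6,2), (7,3)} then 1 else if (m,l) \<in> {(5,1), (6,2), (7,3)} then -1 else 0)"
  "oct_eps l m 5 = (if (l,m) \<in> {(1,4), (7,2), (3,6)} then 1 else if (m,l) \<in> {(1,4), (7,2), (3,6)} then -1 else 0)"
  "oct_eps l m 6 = (if (l,m) \<in> {(1,7), (2,4), (5,3)} then 1 else if (m,l) \<in> {(1,7), (2,4), (5,3)} then -1 else 0)"
  "oct_eps l m 7 = (if (l,m) \<in> {(6,1), (2,5), (3,4)} then 1 else if (m,l) \<in> {(6,1), (2,5), (3,4)} then -1 else 0)"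
  unfolding oct_eps_def oct_triples_def
  by (simp_all add: disj_ac)

lemma oct_mult_nth:
  "(x \<odot> y) $ 0 = x$0*y$0 - x$1*y$1 - x$2*y$2 - x$3*y$3 - x$4*y$4 - x$5*y$5 - x$6*y$6 - x$7*y$7"
  "(x \<odot> y) $ 1 = x$0*y$1 + x$1*y$0 + x$2*y$3 - x$3*y$2 + x$4*y$5 - x$5*y$4 - x$6*y$7 + x$7*y$6"
  "(x \<odot> y) $ 2 = x$0*y$2 + x$2*y$0 + x$3*y$1 - x$1*y$3 + x$4*y$6 - x$6*y$4 + x$5*y$7 - x$7*y$5"
  "(x \<odot> y) $ 3 = x$0*y$3 + x$3*y$0 + x$1*y$2 - x$2*y$1 + x$4*y$7 - x$7*y$4 + x$6*y$5 - x$5*y$6"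
  "(x \<odot> y) $ 4 = x$0*y$4 + x$4*y$0 + x$5*y$1 - x$1*y$5 + x$6*y$2 - x$2*y$6 + x$7*y$3 - x$3*y$7"
  "(x \<odot> y) $ 5 = x$0*y$5 + x$5*y$0 + x$1*y$4 - x$4*y$1 + x$7*y$2 - x$2*y$7 + x$3*y$6 - x$6*y$3"
  "(x \<odot> y) $ 6 = x$0*y$6 + x$6*y$0 + x$1*y$7 - x$7*y$1 + x$2*y$4 - x$4*y$2 + x$5*y$3 - x$3*y$5"
  "(x \<odot> y) $ 7 = x$0*y$7 + x$7*y$0 + x$6*y$1 - x$1*y$6 + x$2*y$5 - x$5*y$2 + x$3*y$4 - x$4*y$3"
  unfolding oct_mult_def sum_8
  by (simp_all add: oct_basis_mult_nth oct_eps_fixed)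

lemma bounded_bilinear_oct_mult: "bounded_bilinear (\<odot>)"
proof -
  have "bilinear (\<odot>)"
    by (auto simp: bilinear_def oct_mult_def linear_iff algebra_simps sum.distrib scaleR_sum_right)
  then show ?thesis by (rule bilinear_conv_bounded_bilinear[THEN iffD1])
qed

interpretation oct_mult: bounded_bilinear "(\<odot>)" by (rule bounded_bilinear_oct_mult)

lemma norm_oct_sq: "(norm (x::octonion))\<^sup>2
   = (x$0)^2 + (x$1)^2 + (x$2)^2 + (x$3)^2 + (x$4)^2 + (x$5)^2 + (x$6)^2 + (x$7)^2"
  unfolding power2_norm_eq_inner inner_vec_def sum_8 by (simp add: power2_eq_square)

text \<open>Left alternativity, x (x y) = (x x) y, for imaginary x. It replaces associativity: the
  product identities below are derived from it.\<close>

lemma imag_mult_imag_mult: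
  assumes "x $ 0 = 0"
  shows "x \<odot> (x \<odot> y) = - ((norm x)\<^sup>2 *\<^sub>R y)"
  using assms unfolding norm_oct_sq vec_eq_iff forall_8
  by (simp add: oct_mult_nth power2_eq_square algebra_simps)

lemma oct_mult_cancel_imag:
  assumes "x $ 0 = 0" "x \<noteq> 0" "x \<odot> y = 0"
  shows "y = 0"
  using imag_mult_imag_mult[OF assms(1), of y] assms(2,3) by (simp add: oct_mult.zero_right)

text \<open>Polarisation of \<open>imag_mult_imag_mult\<close>: for orthogonal \<open>x\<close> and
  \<open>y\<close> the squared norm of \<open>x + y\<close> has no cross term.\<close>

lemma imag_anticommute:
  assumes "x $ 0 = 0" "y $ 0 = 0" "x \<bullet> y = 0"
  shows "x \<odot> (y \<odot> v) = - (y \<odot> (x \<odot> v))"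
proof -
  have "(x + y) \<odot> ((x + y) \<odot> v) = - ((norm (x + y))\<^sup>2 *\<^sub>R v)"
    by (rule imag_mult_imag_mult) (use assms in simp)
  moreover have "(norm (x + y))\<^sup>2 = (norm x)\<^sup>2 + (norm y)\<^sup>2"
    using assms(3) by (simp add: power2_norm_eq_inner inner_add_left inner_add_right inner_commute)
  ultimately show ?thesis
    using imag_mult_imag_mult[OF assms(1), of v] imag_mult_imag_mult[OF assms(2), of v]
    by (simp add: oct_mult.add_left oct_mult.add_right scaleR_left_distrib algebra_simps add_eq_0_iff2)
qed

lemma oct_e_inner: "x \<bullet> oct_e l = x $ l" "oct_e l \<bullet> x = x $ l"
  by (simp_all add: oct_e_def inner_axis inner_axis')

lemma norm_oct_e: "norm (oct_e l) = 1" by (simp add: oct_e_def)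

lemma oct_expand: "x = (\<Sum>l\<in>UNIV. x $ l *\<^sub>R oct_e l)"
  by (simp add: vec_eq_iff oct_e_nth if_distrib [of "(*) _"] cong: if_cong)

lemma oct_Im_eq: "oct_Im x = x - x $ 0 *\<^sub>R oct_e 0"
proof -
  have "(\<Sum>l\<in>UNIV. x $ l *\<^sub>R oct_e l) = x $ 0 *\<^sub>R oct_e 0 + oct_Im x"
    unfolding oct_Im_def sum_8 Collect_one_le_8 by (simp add: add.assoc)
  then show ?thesis using oct_expand[of x] by (simp add: algebra_simps)
qed

lemma e_mult_e_mult:
  assumes "m \<noteq> 0" "n \<noteq> 0" "m \<noteq> n"
  shows "oct_e m \<odot> (oct_e n \<odot> (oct_e n \<odot> v)) = - (oct_e m \<odot> v)"
    "oct_e m \<odot> (oct_e n \<odot> (oct_e m \<odot> v)) = oct_e n \<odot> v"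
proof -
  have *: "oct_e l \<odot> (oct_e l \<odot> y) = - y" if "l \<noteq> 0" for l y
    using that by (subst imag_mult_imag_mult) (simp_all add: oct_e_nth norm_oct_e)
  show "oct_e m \<odot> (oct_e n \<odot> (oct_e n \<odot> v)) = - (oct_e m \<odot> v)"
    using assms by (simp add: * oct_mult.minus_right)
  have "oct_e n \<odot> (oct_e m \<odot> v) = - (oct_e m \<odot> (oct_e n \<odot> v))"
    using assms by (intro imag_anticommute) (simp_all add: oct_e_nth oct_e_inner)
  then show "oct_e m \<odot> (oct_e n \<odot> (oct_e m \<odot> v)) = oct_e n \<odot> v"
    using assms by (simp add: * oct_mult.minus_right)
qed

lemma sum_pairs_8:
  "(\<Sum>(m, n)\<in>{(m, n::8). 1 \<le> m \<and> m < n}. g m n) = (\<Sum>m | 1 \<le> m. \<Sum>n\<in>{m<..}. g m n)"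
proof -
  have "{(m, n::8). 1 \<le> m \<and> m < n} = (SIGMA m:{m. 1 \<le> m}. {m<..})" by auto
  then show ?thesis by (simp add: sum.Sigma)
qed

text \<open>The vectors \<open>J $ m *\<^sub>R oct_e n - J $ n *\<^sub>R oct_e m\<close> are the
  directions of the rotations \<open>oct_L m n\<close> at \<open>J\<close>. By the Clifford
  relations of \<open>e_mult_e_mult\<close>, a pair contributes only the parts of
  \<open>- (J \<odot> v)\<close> with indices \<open>m\<close> and \<open>n\<close>; every imaginary
  index lies in six pairs.\<close>

lemma sum_tangential:
  assumes "J $ 0 = 0"
  shows "(\<Sum>(m, n)\<in>{(m, n). 1 \<le> m \<and> m < n}.
      oct_e m \<odot> (oct_e n \<odot> ((J $ m *\<^sub>R oct_e n - J $ n *\<^sub>R oct_e m) \<odot> v))) = - 6 *\<^sub>R (J \<odot> v)"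
proof -
  have "(\<Sum>(m, n)\<in>{(m, n). 1 \<le> m \<and> m < n}.
      oct_e m \<odot> (oct_e n \<odot> ((J $ m *\<^sub>R oct_e n - J $ n *\<^sub>R oct_e m) \<odot> v)))
    = (\<Sum>(m, n)\<in>{(m, n). 1 \<le> m \<and> m < n}. - (J $ m *\<^sub>R (oct_e m \<odot> v)) - J $ n *\<^sub>R (oct_e n \<odot> v))"
  proof (intro sum.cong refl, clarify)
    fix m n :: 8 assume mn: "1 \<le> m" "m < n"
    then have "1 \<le> n" by order
    then have "m \<noteq> 0" "n \<noteq> 0" "m \<noteq> n" using mn by (auto simp: one_le_8)
    then show "oct_e m \<odot> (oct_e n \<odot> ((J $ m *\<^sub>R oct_e n - J $ n *\<^sub>R oct_e m) \<odot> v))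
        = - (J $ m *\<^sub>R (oct_e m \<odot> v)) - J $ n *\<^sub>R (oct_e n \<odot> v)"
      by (simp add: oct_mult.diff_left oct_mult.diff_right oct_mult.scaleR_left
          oct_mult.scaleR_right e_mult_e_mult)
  qed
  also have "\<dots> = - 6 *\<^sub>R (\<Sum>l\<in>UNIV. J $ l *\<^sub>R (oct_e l \<odot> v))"
    unfolding sum_pairs_8 Collect_one_le_8 sum_8 using assms
    by (simp add: vec_eq_iff greaterThan_8 algebra_simps)
  also have "(\<Sum>l\<in>UNIV. J $ l *\<^sub>R (oct_e l \<odot> v)) = J \<odot> v"
    by (subst (2) oct_expand[of J]) (simp add: oct_mult.sum_left oct_mult.scaleR_left)
  finally show ?thesis .
qed

section \<open>Complex coordinates on slices and the sphere of imaginary units\<close>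

definition slice_pt :: "octonion \<Rightarrow> complex \<Rightarrow> octonion" where
  "slice_pt J z = oct_of_real (Re z) + Im z *\<^sub>R J"

lemma imag_unitsD: "J \<in> imag_units \<Longrightarrow> J $ 0 = 0" "J \<in> imag_units \<Longrightarrow> norm J = 1"
  by (simp_all add: imag_units_def oct_Re_def)

lemma imag_unitsI: "J $ 0 = 0 \<Longrightarrow> norm J = 1 \<Longrightarrow> J \<in> imag_units"
  by (simp add: imag_units_def oct_Re_def)

lemma imag_units_minus: "J \<in> imag_units \<Longrightarrow> - J \<in> imag_units"
  by (simp add: imag_units_def oct_Re_def)

lemma norm_sq_split:
  assumes "y $ 0 = 0"
  shows "(norm (a *\<^sub>R oct_e 0 + y))\<^sup>2 = a\<^sup>2 + (norm y)\<^sup>2"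
  using assms unfolding power2_norm_eq_inner
  by (simp add: inner_add_left inner_add_right oct_e_inner power2_eq_square oct_e_nth)

lemma slice_pt_0: "J \<in> imag_units \<Longrightarrow> slice_pt J z $ 0 = Re z"
  by (simp add: slice_pt_def oct_of_real_def oct_e_nth imag_unitsD)

lemma oct_Im_slice_pt: "J \<in> imag_units \<Longrightarrow> oct_Im (slice_pt J z) = Im z *\<^sub>R J"
  by (simp add: oct_Im_eq slice_pt_0) (simp add: slice_pt_def oct_of_real_def)

lemma slice_pt_minus: "slice_pt (- J) z = slice_pt J (cnj z)"
  by (simp add: slice_pt_def)

lemma slice_pt_real: "Im z = 0 \<Longrightarrow> slice_pt J z = oct_of_real (Re z)"
  by (simp add: slice_pt_def)

text \<open>The law of cosines. The units enter only through \<open>J \<bullet> K\<close>, so a ball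
  cuts out a spherical cap of units for each fixed coordinate.\<close>

lemma dist_slice_pt:
  assumes "J \<in> imag_units" "K \<in> imag_units"
  shows "(dist (slice_pt J z) (slice_pt K w))\<^sup>2
    = (Re z - Re w)\<^sup>2 + ((Im z)\<^sup>2 + (Im w)\<^sup>2 - 2 * Im z * Im w * (J \<bullet> K))"
proof -
  have "slice_pt J z - slice_pt K w = (Re z - Re w) *\<^sub>R oct_e 0 + (Im z *\<^sub>R J - Im w *\<^sub>R K)"
    by (simp add: slice_pt_def oct_of_real_def algebra_simps)
  then have "(dist (slice_pt J z) (slice_pt K w))\<^sup>2 = (Re z - Re w)\<^sup>2 + (norm (Im z *\<^sub>R J - Im w *\<^sub>R K))\<^sup>2"
    using assms by (simp add: dist_norm norm_sq_split imag_unitsD)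
  moreover have "J \<bullet> J = 1" "K \<bullet> K = 1" using assms by (simp_all add: imag_unitsD flip: power2_norm_eq_inner)
  then have "(norm (Im z *\<^sub>R J - Im w *\<^sub>R K))\<^sup>2 = (Im z)\<^sup>2 + (Im w)\<^sup>2 - 2 * Im z * Im w * (J \<bullet> K)"
    unfolding power2_norm_eq_inner
    by (simp add: inner_diff_left inner_diff_right inner_commute[of K J] power2_eq_square algebra_simps)
  ultimately show ?thesis by simp
qed

lemma dist_slice_pt_same:
  assumes "J \<in> imag_units"
  shows "dist (slice_pt J z) (slice_pt J w) = dist z w"
proof -
  have "(dist (slice_pt J z) (slice_pt J w))\<^sup>2 = (dist z w)\<^sup>2"
    using dist_slice_pt[OF assms assms, of z w] imag_unitsD(2)[OF assms]
    by (simp add: dist_norm cmod_power2 power2_diff flip: power2_norm_eq_inner)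
  then show ?thesis by simp
qed

lemma dist_slice_pt_unit: "dist (slice_pt J z) (slice_pt K z) = \<bar>Im z\<bar> * dist J K"
  by (simp add: slice_pt_def dist_norm flip: scaleR_right_diff_distrib)

text \<open>By Cauchy-Schwarz, points with given coordinates in the closed upper half plane are
  closest when they share a slice. So octonions near \<open>slice_pt I z0\<close> have coordinates
  near \<open>z0\<close>.\<close>

lemma dist_le_dist_slice_pt:
  assumes "J \<in> imag_units" "K \<in> imag_units" "0 \<le> Im z" "0 \<le> Im w"
  shows "dist z w \<le> dist (slice_pt J z) (slice_pt K w)"
proof (rule power2_le_imp_le)
  have "J \<bullet> K \<le> norm J * norm K" by (rule norm_cauchy_schwarz)
  then have "J \<bullet> K \<le> 1" using assms by (simp add: imag_unitsD)
  then have "Im z * Im w * (J \<bullet> K) \<le> Im z * Im w * 1" using assms by (intro mult_left_mono) auto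
  then show "(dist z w)\<^sup>2 \<le> (dist (slice_pt J z) (slice_pt K w))\<^sup>2"
    unfolding dist_slice_pt[OF assms(1,2)] by (simp add: dist_norm cmod_power2 power2_diff)
qed simp

lemma continuous_slice_pt [continuous_intros]:
  "continuous_on X g \<Longrightarrow> continuous_on X (\<lambda>x. slice_pt J (g x))"
  unfolding slice_pt_def oct_of_real_def by (intro continuous_intros)

lemma slice_pt_has_derivative: "(slice_pt J has_derivative slice_pt J) (at z)"
proof -
  have "bounded_linear (slice_pt J)"
    unfolding slice_pt_def oct_of_real_def
    by (intro bounded_linear_add bounded_linear_compose[OF bounded_linear_scaleR_left] bounded_linear_Re bounded_linear_Im)
  then show ?thesis by (rule bounded_linear_imp_has_derivative)
qed

lemma imag_unit_exists: obtains J where "J \<in> imag_units"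
  by (rule that[of "oct_e 1"]) (simp add: imag_units_def oct_Re_def oct_e_nth norm_oct_e)

lemma slice_pt_cases:
  obtains J z where "J \<in> imag_units" "0 \<le> Im z" "x = slice_pt J z"
proof (cases "oct_Im x = 0")
  case True
  obtain J where "J \<in> imag_units" by (rule imag_unit_exists)
  moreover have "x = slice_pt J (of_real (x $ 0))"
    using True by (simp add: oct_Im_eq slice_pt_def oct_of_real_def)
  ultimately show ?thesis by (intro that) auto
next
  case False
  define J where "J = (1 / norm (oct_Im x)) *\<^sub>R oct_Im x"
  have "oct_Im x $ 0 = 0" by (simp add: oct_Im_eq oct_e_nth)
  then have "J \<in> imag_units" using False by (intro imag_unitsI) (simp_all add: J_def)
  moreover have "x = slice_pt J (Complex (x $ 0) (norm (oct_Im x)))"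
    using False by (simp add: slice_pt_def oct_of_real_def J_def) (simp add: oct_Im_eq)
  ultimately show ?thesis by (intro that) auto
qed

lemma slice_pt_in_reals_iff:
  assumes "J \<in> imag_units"
  shows "slice_pt J z \<in> oct_reals \<longleftrightarrow> Im z = 0"
proof
  assume "slice_pt J z \<in> oct_reals"
  then obtain a where "slice_pt J z = oct_of_real a" by (auto simp: oct_reals_def)
  then have "oct_Im (slice_pt J z) = 0" by (simp add: oct_Im_eq oct_of_real_def oct_e_nth)
  then have "norm (Im z *\<^sub>R J) = 0" using assms by (simp add: oct_Im_slice_pt)
  then show "Im z = 0" using assms by (simp add: imag_unitsD)
qed (simp add: slice_pt_real oct_reals_def)

lemma imag_unit_orthogonal:
  assumes "J \<in> imag_units"
  obtains N where "N \<in> imag_units" "J \<bullet> N = 0"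
proof (cases "J $ 1 = 0 \<and> J $ 2 = 0")
  case True
  then show ?thesis
    by (intro that[of "oct_e 1"] imag_unitsI) (simp_all add: oct_e_nth norm_oct_e oct_e_inner)
next
  case False
  define w where "w = J $ 2 *\<^sub>R oct_e 1 - J $ 1 *\<^sub>R oct_e 2"
  have "w $ 1 \<noteq> 0 \<or> w $ 2 \<noteq> 0" using False by (auto simp: w_def oct_e_nth)
  then have w: "w \<noteq> 0" by auto
  have "w $ 0 = 0" by (simp add: w_def oct_e_nth)
  moreover have "J \<bullet> w = 0" by (simp add: w_def inner_diff_right oct_e_inner)
  ultimately show ?thesis
    using w by (intro that[of "(1 / norm w) *\<^sub>R w"] imag_unitsI) simp_all
qed

lemma imag_units_combine:
  assumes "J \<in> imag_units" "N \<in> imag_units" "J \<bullet> N = 0" "x\<^sup>2 + y\<^sup>2 = 1"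
  shows "x *\<^sub>R J + y *\<^sub>R N \<in> imag_units"
proof (rule imag_unitsI)
  have "(norm (x *\<^sub>R J + y *\<^sub>R N))\<^sup>2 = x\<^sup>2 * (norm J)\<^sup>2 + y\<^sup>2 * (norm N)\<^sup>2"
    using assms(3) unfolding power2_norm_eq_inner
    by (simp add: inner_add_left inner_add_right inner_commute[of N J] power2_eq_square)
  then have "(norm (x *\<^sub>R J + y *\<^sub>R N))\<^sup>2 = 1\<^sup>2" using assms by (simp add: imag_unitsD)
  then show "norm (x *\<^sub>R J + y *\<^sub>R N) = 1" by (simp only: power2_eq_iff_nonneg norm_ge_zero zero_le_one)
qed (use assms in \<open>simp add: imag_unitsD\<close>)

text \<open>Supplies the second unit needed to recover \<open>u\<close> and \<open>v\<close> from
  values \<open>u + J \<odot> v\<close>. It lies on a great circle through \<open>J\<close>.\<close>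

lemma imag_unit_near:
  assumes J: "J \<in> imag_units" and e: "0 < e"
  obtains K where "K \<in> imag_units" "K \<noteq> J" "dist K J < e"
proof -
  obtain N where N: "N \<in> imag_units" "J \<bullet> N = 0" using imag_unit_orthogonal[OF J] .
  define g where "g t = cos t *\<^sub>R J + sin t *\<^sub>R N" for t
  have "isCont g 0" unfolding g_def by (intro continuous_intros)
  then obtain d where d: "0 < d" "\<And>t. dist t 0 < d \<Longrightarrow> dist (g t) (g 0) < e"
    using e unfolding continuous_at_eps_delta by blast
  define t where "t = min (d / 2) 1"
  have t: "0 < t" "t < d" "t \<le> 1" using d(1) by (auto simp: t_def)
  have "t < pi" using t pi_gt3 by linarith
  show ?thesis
  proof (rule that[of "g t"])
    show "g t \<in> imag_units" unfolding g_def by (rule imag_units_combine[OF J N]) simp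
    show "dist (g t) J < e" using d(2)[of t] t by (simp add: g_def)
    have "g t \<bullet> N = sin t"
      using N by (simp add: g_def inner_add_left imag_unitsD flip: power2_norm_eq_inner)
    moreover have "0 < sin t" using t \<open>t < pi\<close> by (intro sin_gt_zero)
    ultimately show "g t \<noteq> J" using N(2) by auto
  qed
qed

subsection \<open>Local description of slice Fueter-regular functions\<close>

lemma partial_deriv_eq:
  assumes "(f has_derivative T) (at x)"
  shows "partial_deriv l f x = T (oct_e l)"
proof -
  have "((\<lambda>t. x + t *\<^sub>R oct_e l) has_derivative (\<lambda>h. h *\<^sub>R oct_e l)) (at 0)"
    by (auto intro!: derivative_eq_intros)
  from has_derivative_compose[OF this, of f T]
  have "((\<lambda>t. f (x + t *\<^sub>R oct_e l)) has_derivative (\<lambda>h. T (h *\<^sub>R oct_e l))) (at 0)"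
    using assms by simp
  moreover have "linear T" using assms by (rule has_derivative_linear)
  ultimately have "((\<lambda>t. f (x + t *\<^sub>R oct_e l)) has_vector_derivative T (oct_e l)) (at 0)"
    by (simp add: has_vector_derivative_def linear_scale)
  then show ?thesis unfolding partial_deriv_def by (rule vector_derivative_at)
qed

text \<open>
  The sphere of imaginary units is used only near \<open>J\<close>: it determines the derivative of \<open>f\<close> in the
  directions orthogonal to \<open>J\<close>, hence the spherical part \<open>oct_Gamma\<close>.
\<close>

lemma dbar_F_slice_pt:
  assumes J: "J \<in> imag_units" and b: "Im z \<noteq> 0"
    and T: "(f has_derivative T) (at (slice_pt J z))"
    and e: "0 < e" and rep: "\<And>K. K \<in> imag_units \<Longrightarrow> dist K J < e \<Longrightarrow> f (slice_pt K z) = u + K \<odot> v"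
  shows "dbar_F f (slice_pt J z) = T (oct_e 0) + J \<odot> T J - (2 / Im z) *\<^sub>R v"
proof -
  let ?x = "slice_pt J z" and ?b = "Im z"
  have lin: "linear T" using T by (rule has_derivative_linear)
  note [simp] = linear_add[OF lin] linear_diff[OF lin] linear_scale[OF lin] linear_0[OF lin]
  have J0: "J $ 0 = 0" using J by (rule imag_unitsD)
  have x_nth: "?x $ l = ?b * J $ l" if "l \<noteq> 0" for l
    using that by (simp add: slice_pt_def oct_of_real_def oct_e_nth)
  \<comment> \<open>\<open>f\<close> is differentiated in two ways along the great circle from
    \<open>J\<close> towards \<open>N\<close>: by the chain rule, and through the form
    \<open>u + \<gamma> t \<odot> v\<close> that it has near \<open>J\<close>.\<close>
  have unit: "?b *\<^sub>R T N = N \<odot> v" if N: "N \<in> imag_units" "J \<bullet> N = 0" for N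
  proof -
    define \<gamma> where "\<gamma> t = cos t *\<^sub>R J + sin t *\<^sub>R N" for t
    have \<gamma>': "(\<gamma> has_vector_derivative N) (at 0)"
      unfolding \<gamma>_def by (auto intro!: derivative_eq_intros)
    have "((\<lambda>t. slice_pt (\<gamma> t) z) has_vector_derivative ?b *\<^sub>R N) (at 0)"
      unfolding slice_pt_def
      using has_vector_derivative_add[OF has_vector_derivative_const
          bounded_linear.has_vector_derivative[OF bounded_linear_scaleR_right \<gamma>', of ?b]]
      by simp
    then have "((\<lambda>t. f (slice_pt (\<gamma> t) z)) has_vector_derivative T (?b *\<^sub>R N)) (at 0)"
      using vector_derivative_diff_chain_within[of "\<lambda>t. slice_pt (\<gamma> t) z" "?b *\<^sub>R N" 0 UNIV f T] T
      by (simp add: o_def \<gamma>_def has_derivative_at_withinI)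
    moreover have "((\<lambda>t. f (slice_pt (\<gamma> t) z)) has_vector_derivative N \<odot> v) (at 0)"
    proof -
      have "isCont \<gamma> 0" using \<gamma>' by (rule has_vector_derivative_continuous)
      then obtain d where d: "0 < d" "\<And>t. dist t 0 < d \<Longrightarrow> dist (\<gamma> t) (\<gamma> 0) < e"
        using e unfolding continuous_at_eps_delta by blast
      show ?thesis
      proof (rule has_vector_derivative_transform_within_open)
        show "((\<lambda>t. u + \<gamma> t \<odot> v) has_vector_derivative N \<odot> v) (at 0)"
          using bounded_linear.has_vector_derivative[OF oct_mult.bounded_linear_left \<gamma>', of v]
          by (auto intro!: derivative_eq_intros)
        show "u + \<gamma> t \<odot> v = f (slice_pt (\<gamma> t) z)" if "t \<in> ball 0 d" for t
        proof (rule rep[symmetric])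
          show "\<gamma> t \<in> imag_units" unfolding \<gamma>_def by (rule imag_units_combine[OF J N]) simp
          show "dist (\<gamma> t) J < e" using d(2)[of t] that by (simp add: \<gamma>_def dist_commute)
        qed
      qed (use d in auto)
    qed
    ultimately show ?thesis using vector_derivative_unique_at by fastforce
  qed
  have tangential: "?b *\<^sub>R T w = w \<odot> v" if w: "w $ 0 = 0" "J \<bullet> w = 0" for w
  proof (cases "w = 0")
    case True then show ?thesis by (simp add: oct_mult.zero_left)
  next
    case False
    have "?b *\<^sub>R T ((1 / norm w) *\<^sub>R w) = ((1 / norm w) *\<^sub>R w) \<odot> v"
      by (rule unit) (use w False in \<open>auto intro: imag_unitsI\<close>)
    then have "norm w *\<^sub>R (?b *\<^sub>R T ((1 / norm w) *\<^sub>R w)) = norm w *\<^sub>R (((1 / norm w) *\<^sub>R w) \<odot> v)" by simp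
    then show ?thesis using False by (simp add: oct_mult.scaleR_left)
  qed
  have L: "oct_L m n f ?x = (J $ m *\<^sub>R oct_e n - J $ n *\<^sub>R oct_e m) \<odot> v" if mn: "m \<noteq> 0" "n \<noteq> 0" for m n
  proof -
    have "oct_L m n f ?x = ?b *\<^sub>R T (J $ m *\<^sub>R oct_e n - J $ n *\<^sub>R oct_e m)"
      using mn by (simp add: oct_L_def partial_deriv_eq[OF T] x_nth scaleR_diff_right)
    also have "\<dots> = (J $ m *\<^sub>R oct_e n - J $ n *\<^sub>R oct_e m) \<odot> v"
      using mn by (intro tangential) (simp_all add: oct_e_nth inner_diff_right oct_e_inner)
    finally show ?thesis .
  qed
  have "oct_Gamma f ?x = - (\<Sum>(m, n)\<in>{(m, n). 1 \<le> m \<and> m < n}.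
      oct_e m \<odot> (oct_e n \<odot> ((J $ m *\<^sub>R oct_e n - J $ n *\<^sub>R oct_e m) \<odot> v)))"
    unfolding oct_Gamma_def
  proof (intro arg_cong[of _ _ uminus] sum.cong refl, clarify)
    fix m n :: 8 assume mn: "1 \<le> m" "m < n"
    then have "1 \<le> n" by order
    then have "m \<noteq> 0" "n \<noteq> 0" using mn by (auto simp: one_le_8)
    then show "oct_e m \<odot> (oct_e n \<odot> oct_L m n f ?x)
        = oct_e m \<odot> (oct_e n \<odot> ((J $ m *\<^sub>R oct_e n - J $ n *\<^sub>R oct_e m) \<odot> v))"
      by (simp add: L)
  qed
  then have Gamma: "oct_Gamma f ?x = 6 *\<^sub>R (J \<odot> v)" by (simp add: sum_tangential[OF J0])
  have "oct_Euler f ?x = (\<Sum>l | 1 \<le> l. ?b *\<^sub>R T (J $ l *\<^sub>R oct_e l))"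
    unfolding oct_Euler_def by (intro sum.cong refl) (simp add: partial_deriv_eq[OF T] x_nth one_le_8)
  also have "\<dots> = ?b *\<^sub>R T (oct_Im J)"
    unfolding oct_Im_def by (simp only: linear_sum[OF lin] scaleR_sum_right)
  also have "oct_Im J = J" by (simp add: oct_Im_eq J0)
  finally have Euler: "oct_Euler f ?x = ?b *\<^sub>R T J" .
  have "oct_inverse (oct_Im ?x) = (1 / ?b\<^sup>2) *\<^sub>R (- (?b *\<^sub>R J))"
    unfolding oct_Im_slice_pt[OF J] oct_inverse_def
    using J J0 by (simp add: imag_unitsD oct_Re_def oct_of_real_def oct_Im_eq)
  then have inv: "oct_inverse (oct_Im ?x) = (- 1 / ?b) *\<^sub>R J"
    using b by (simp add: power2_eq_square)
  have JJ: "J \<odot> (J \<odot> v) = - v" using imag_mult_imag_mult[OF J0] J by (simp add: imag_unitsD)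
  \<comment> \<open>The inverse is \<open>- J / Im z\<close>. So the Euler term becomes
    \<open>J \<odot> T J\<close>, and the spherical term becomes \<open>(6/3) / Im z\<close> times
    \<open>J \<odot> (J \<odot> v) = - v\<close>.\<close>
  show ?thesis
    unfolding dbar_F_def inv Gamma Euler partial_deriv_eq[OF T]
    using b by (simp add: oct_mult.scaleR_left oct_mult.scaleR_right oct_mult.minus_left JJ)
qed

text \<open>The cap is the radial projection of the cone \<open>c * norm y < I \<bullet> y\<close>.
  The cone is convex because \<open>c \<ge> 0\<close>, and the strict inequality excludes the
  origin.\<close>

lemma connected_unit_cap:
  assumes "0 \<le> c"
  shows "connected {J \<in> imag_units. c < I \<bullet> J}"
proof -
  define C where "C = {y::octonion. y $ 0 = 0 \<and> c * norm y < I \<bullet> y}"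
  have "convex C"
    unfolding convex_alt
  proof (intro ballI allI impI)
    fix x y :: octonion and t :: real assume xy: "x \<in> C" "y \<in> C" and t: "0 \<le> t \<and> t \<le> 1"
    have "norm ((1 - t) *\<^sub>R x + t *\<^sub>R y) \<le> (1 - t) * norm x + t * norm y"
      using norm_triangle_ineq[of "(1 - t) *\<^sub>R x" "t *\<^sub>R y"] t by simp
    then have "c * norm ((1 - t) *\<^sub>R x + t *\<^sub>R y) \<le> c * ((1 - t) * norm x + t * norm y)"
      using assms by (rule mult_left_mono)
    also have "\<dots> = (1 - t) * (c * norm x) + t * (c * norm y)" by (simp add: algebra_simps)
    also have "\<dots> < (1 - t) * (I \<bullet> x) + t * (I \<bullet> y)"
    proof (cases "t = 0")
      case True then show ?thesis using xy by (simp add: C_def)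
    next
      case False
      then have "t * (c * norm y) < t * (I \<bullet> y)" using xy t by (simp add: C_def)
      moreover have "(1 - t) * (c * norm x) \<le> (1 - t) * (I \<bullet> x)"
        using xy t by (intro mult_left_mono) (auto simp: C_def)
      ultimately show ?thesis by linarith
    qed
    finally show "(1 - t) *\<^sub>R x + t *\<^sub>R y \<in> C"
      using xy by (simp add: C_def inner_add_right)
  qed
  have nz: "y \<noteq> 0" if "y \<in> C" for y using that by (auto simp: C_def)
  have "continuous_on C (\<lambda>y. (1 / norm y) *\<^sub>R y)"
    using nz by (intro continuous_intros) auto
  then have "connected ((\<lambda>y. (1 / norm y) *\<^sub>R y) ` C)"
    by (rule connected_continuous_image) (rule convex_connected[OF \<open>convex C\<close>])
  also have "(\<lambda>y. (1 / norm y) *\<^sub>R y) ` C = {J \<in> imag_units. c < I \<bullet> J}"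
  proof (intro equalityI subsetI)
    fix J assume "J \<in> (\<lambda>y. (1 / norm y) *\<^sub>R y) ` C"
    then obtain y where y: "y \<in> C" "J = (1 / norm y) *\<^sub>R y" by blast
    have "0 < norm y" using nz[OF y(1)] by simp
    then show "J \<in> {J \<in> imag_units. c < I \<bullet> J}"
      using y by (auto simp: C_def field_simps intro!: imag_unitsI)
  next
    fix J assume J: "J \<in> {J \<in> imag_units. c < I \<bullet> J}"
    then have "J \<in> C" "J = (1 / norm J) *\<^sub>R J" by (simp_all add: C_def imag_unitsD)
    then show "J \<in> (\<lambda>y. (1 / norm y) *\<^sub>R y) ` C" by blast
  qed
  finally show ?thesis .
qed

text \<open>Radial projection again, now of the punctured space of imaginary octonions. A convex set
  stays connected without one point unless its dimension is 1, which two orthogonal units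
  exclude.\<close>

lemma connected_imag_units: "connected imag_units"
proof -
  obtain I where I: "I \<in> imag_units" by (rule imag_unit_exists)
  obtain N where N: "N \<in> imag_units" "I \<bullet> N = 0" by (rule imag_unit_orthogonal[OF I])
  let ?S = "{y::octonion. y $ 0 = 0}"
  have sub: "subspace ?S" by (simp add: subspace_def)
  have "aff_dim ?S \<noteq> 1"
  proof
    assume "aff_dim ?S = 1"
    then have "dim ?S = 1" using aff_dim_subspace[OF sub] by simp
    moreover have "independent {I, N}"
    proof (rule pairwise_orthogonal_independent)
      show "pairwise orthogonal {I, N}"
        using N by (auto simp: pairwise_def orthogonal_def inner_commute)
      show "0 \<notin> {I, N}" using I N by (auto simp: imag_unitsD dest: imag_unitsD(2))
    qed
    moreover have "card {I, N} = 2"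
    proof -
      have "I \<bullet> I = 1" using I by (simp add: imag_unitsD flip: power2_norm_eq_inner)
      then have "I \<noteq> N" using N by auto
      then show ?thesis by simp
    qed
    moreover have "card {I, N} \<le> dim ?S"
      by (rule independent_card_le_dim) (use I N calculation in \<open>auto simp: imag_unitsD\<close>)
    ultimately show False by simp
  qed
  then have "connected (?S - {0})"
    using subspace_imp_convex[OF sub] by (rule connected_punctured_convex[rotated])
  moreover have "continuous_on (?S - {0}) (\<lambda>y. (1 / norm y) *\<^sub>R y)"
    by (intro continuous_intros) auto
  ultimately have "connected ((\<lambda>y. (1 / norm y) *\<^sub>R y) ` (?S - {0}))"
    by (intro connected_continuous_image)
  also have "(\<lambda>y. (1 / norm y) *\<^sub>R y) ` (?S - {0}) = imag_units"
  proof (intro equalityI subsetI)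
    fix J assume J: "J \<in> imag_units"
    then have "J \<in> ?S - {0}" "J = (1 / norm J) *\<^sub>R J" by (auto simp: imag_unitsD dest: imag_unitsD(2))
    then show "J \<in> (\<lambda>y. (1 / norm y) *\<^sub>R y) ` (?S - {0})" by blast
  qed (auto intro!: imag_unitsI)
  finally show ?thesis .
qed

section \<open>From slice functions to stem functions\<close>

lemma isCont_eq_const:
  fixes g :: "'a::real_normed_vector \<Rightarrow> 'b::t2_space"
  assumes "isCont g x" and "\<forall>\<^sub>F t in at (0::real). g (x + t *\<^sub>R d) = c"
  shows "g x = c"
proof -
  have "isCont (\<lambda>t. x + t *\<^sub>R d) 0" by (intro continuous_intros)
  then have "isCont (\<lambda>t. g (x + t *\<^sub>R d)) 0"
    by (rule isCont_o2) (use assms(1) in simp)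
  then have "((\<lambda>t. g (x + t *\<^sub>R d)) \<longlongrightarrow> g x) (at 0)" by (simp add: isCont_def)
  moreover have "((\<lambda>t. g (x + t *\<^sub>R d)) \<longlongrightarrow> c) (at 0)"
    by (rule tendsto_eventually[OF assms(2)])
  ultimately show ?thesis by (rule tendsto_unique[rotated]) simp
qed

lemma eventually_line_in_open:
  fixes x d :: "'a::real_normed_vector"
  assumes "open S" "x \<in> S"
  shows "\<forall>\<^sub>F t in at (0::real). x + t *\<^sub>R d \<in> S"
proof -
  have "((\<lambda>t. x + t *\<^sub>R d) \<longlongrightarrow> x + 0 *\<^sub>R d) (at (0::real))" by (intro tendsto_intros)
  then show ?thesis using topological_tendstoD assms by fastforce
qed

text \<open>The units \<open>K\<close> that put \<open>slice_pt K z\<close> into the ball must lie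
  in a single component. About a real centre membership does not depend on \<open>K\<close>;
  otherwise \<open>R \<le> Im z0\<close> makes the set a cap with nonnegative threshold. Coordinates
  below the real axis occur only for real centres and are handled by replacing \<open>K\<close> with
  \<open>- K\<close>.\<close>

lemma slice_function_ball:
  assumes sf: "slice_function \<Omega> f" and sub: "ball (slice_pt I z0) R \<subseteq> \<Omega>"
    and I: "I \<in> imag_units" and b0: "Im z0 = 0 \<or> R \<le> Im z0" and z: "z \<in> ball z0 R"
  obtains u v where "\<And>K. K \<in> imag_units \<Longrightarrow> slice_pt K z \<in> ball (slice_pt I z0) R
    \<Longrightarrow> f (slice_pt K z) = u + K \<odot> v"
proof -
  let ?B = "ball (slice_pt I z0) R"
  have "dist z0 z < R" using z by simp
  then have R: "0 < R" using zero_le_dist[of z0 z] by linarith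
  have pos: "\<exists>u v. \<forall>K\<in>imag_units. slice_pt K z \<in> ?B \<longrightarrow> f (slice_pt K z) = u + K \<odot> v"
    if b: "0 < Im z" and z: "z \<in> ball z0 R" for z
  proof -
    let ?C = "{K \<in> imag_units. slice_pt K z \<in> ?B}"
    have in_ball: "slice_pt K z \<in> ?B \<longleftrightarrow>
      (Re z0 - Re z)\<^sup>2 + (Im z0)\<^sup>2 + (Im z)\<^sup>2 - R\<^sup>2 < 2 * Im z0 * Im z * (I \<bullet> K)"
      if "K \<in> imag_units" for K
    proof -
      have "slice_pt K z \<in> ?B \<longleftrightarrow> (dist (slice_pt I z0) (slice_pt K z))\<^sup>2 < R\<^sup>2"
        using R by (auto intro: power2_less_imp_less power_strict_mono)
      then show ?thesis by (simp add: dist_slice_pt[OF I that] algebra_simps)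
    qed
    have "connected ?C"
      using b0
    proof
      assume "Im z0 = 0"
      then have "?C = {} \<or> ?C = imag_units"
        using in_ball by (auto simp del: mem_ball)
      then show ?thesis
      proof
        assume "?C = {}"
        then show ?thesis by (simp only: connected_empty)
      next
        assume "?C = imag_units"
        then show ?thesis by (simp only: connected_imag_units)
      qed
    next
      assume le: "R \<le> Im z0"
      define c where "c = ((Re z0 - Re z)\<^sup>2 + (Im z0)\<^sup>2 + (Im z)\<^sup>2 - R\<^sup>2) / (2 * Im z0 * Im z)"
      have "R\<^sup>2 \<le> (Im z0)\<^sup>2" using le R by (simp add: power_mono)
      then have "0 \<le> (Re z0 - Re z)\<^sup>2 + (Im z0)\<^sup>2 + (Im z)\<^sup>2 - R\<^sup>2"
        using zero_le_power2[of "Re z0 - Re z"] zero_le_power2[of "Im z"] by linarith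
      then have "0 \<le> c" unfolding c_def using le R b by (intro divide_nonneg_pos) auto
      moreover have "?C = {K \<in> imag_units. c < I \<bullet> K}"
      proof -
        have "c < t \<longleftrightarrow> (Re z0 - Re z)\<^sup>2 + (Im z0)\<^sup>2 + (Im z)\<^sup>2 - R\<^sup>2 < 2 * Im z0 * Im z * t" for t
          using le R b by (simp add: c_def pos_divide_less_eq mult.commute)
        then show ?thesis using in_ball by (auto simp del: mem_ball)
      qed
      ultimately show ?thesis by (simp only: connected_unit_cap)
    qed
    moreover have "I \<in> ?C" using I z by (simp add: dist_slice_pt_same)
    moreover have "?C \<subseteq> slice_units \<Omega> (Re z) (Im z)"
      using sub by (auto simp: slice_units_def slice_pt_def subset_iff)
    ultimately obtain \<Lambda> where "\<Lambda> \<in> components (slice_units \<Omega> (Re z) (Im z))" "?C \<subseteq> \<Lambda>"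
      using exists_component_superset[of ?C] by blast
    moreover obtain u v where "\<forall>K\<in>\<Lambda>. f (oct_of_real (Re z) + Im z *\<^sub>R K) = u + K \<odot> v"
      using sf b calculation(1) unfolding slice_function_def by blast
    ultimately show ?thesis unfolding slice_pt_def[symmetric] by blast
  qed
  consider "0 < Im z" | "Im z = 0" | "Im z < 0" by linarith
  then have "\<exists>u v. \<forall>K\<in>imag_units. slice_pt K z \<in> ?B \<longrightarrow> f (slice_pt K z) = u + K \<odot> v"
  proof cases
    case 1 then show ?thesis using pos z by blast
  next
    case 2
    then have "f (slice_pt K z) = f (slice_pt I z) + K \<odot> 0" for K
      by (simp add: slice_pt_real oct_mult.zero_right)
    then show ?thesis by blast
  next
    case 3
    have "\<bar>Im (z0 - z)\<bar> < R" using z abs_Im_le_cmod[of "z0 - z"] by (simp add: dist_norm)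
    then have "Im z0 = 0" using b0 3 by auto
    then have "dist z0 (cnj z) = dist z0 z" by (simp add: dist_norm cmod_def)
    then obtain u v where uv: "\<forall>K\<in>imag_units. slice_pt K (cnj z) \<in> ?B \<longrightarrow> f (slice_pt K (cnj z)) = u + K \<odot> v"
      using pos[of "cnj z"] 3 z by auto
    have "f (slice_pt K z) = u + K \<odot> (- v)" if "K \<in> imag_units" "slice_pt K z \<in> ?B" for K
    proof -
      have "slice_pt (- K) (cnj z) = slice_pt K z" by (simp add: slice_pt_minus)
      then show ?thesis using uv imag_units_minus[OF that(1)] that(2)
        by (metis oct_mult.minus_left oct_mult.minus_right)
    qed
    then show ?thesis by blast
  qed
  then show ?thesis using that by blast
qed

text \<open>Values on two fixed slices, of \<open>I\<close> and \<open>J2\<close>, determine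
  \<open>u\<close> and \<open>v\<close> linearly, so both inherit the differentiability of
  \<open>f\<close>. The equation on these two slices then separates into the two stem
  equations.\<close>

lemma slice_Fueter_local_stem:
  assumes \<Omega>: "open \<Omega>" and reg: "slice_Fueter_regular \<Omega> f" and q: "q \<in> \<Omega>" and \<delta>: "0 < \<delta>"
  obtains r I z0 u v where "0 < r" "r \<le> \<delta>" "I \<in> imag_units" "q = slice_pt I z0"
    "ball q r \<subseteq> \<Omega>" "Im z0 = 0 \<or> r \<le> Im z0" "stem_system (ball z0 r) u v"
    "\<And>J z. J \<in> imag_units \<Longrightarrow> z \<in> ball z0 r \<Longrightarrow> slice_pt J z \<in> ball q r \<Longrightarrow> f (slice_pt J z) = u z + J \<odot> v z"
proof -
  have sf: "slice_function \<Omega> f" and C1: "\<And>x. x \<in> \<Omega> \<Longrightarrow> f differentiable (at x)"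
    "\<And>l. continuous_on \<Omega> (partial_deriv l f)" and dbar: "\<And>x. x \<in> \<Omega> - oct_reals \<Longrightarrow> dbar_F f x = 0"
    using reg unfolding slice_Fueter_regular_def oct_C1_on_def by auto
  obtain I z0 where I: "I \<in> imag_units" and z0: "0 \<le> Im z0" "q = slice_pt I z0"
    by (rule slice_pt_cases)
  obtain R0 where R0: "0 < R0" "ball q R0 \<subseteq> \<Omega>" using \<Omega> q by (rule openE)
  \<comment> \<open>For nonreal \<open>q\<close> the bound \<open>Im z0\<close> keeps the ball off
    the real axis. Half of \<open>R\<close> is reserved for the change of slice:
    \<open>\<bar>Im z\<bar> \<le> Im z0 + R\<close> and the choice of \<open>J2\<close> move a point
    by at most \<open>R / 2\<close>.\<close>
  define R where "R = min (min R0 \<delta>) (if Im z0 = 0 then 1 else Im z0)"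
  have R: "0 < R" "R \<le> \<delta>" "ball q R \<subseteq> \<Omega>" "Im z0 = 0 \<or> R \<le> Im z0"
    using R0 \<delta> z0 by (auto simp: R_def)
  define r where "r = R / 2"
  have r: "0 < r" "r < R" using R by (auto simp: r_def)
  obtain J2 where J2: "J2 \<in> imag_units" "J2 \<noteq> I" "dist J2 I < R / (2 * (Im z0 + R))"
    using imag_unit_near[OF I, of "R / (2 * (Im z0 + R))"] R(1) z0 by auto
  have zR: "z \<in> ball z0 R" if "z \<in> ball z0 r" for z using that r by auto
  have inI: "slice_pt I z \<in> ball q R" if "z \<in> ball z0 r" for z
    using zR[OF that] I by (simp add: z0 dist_slice_pt_same)
  have inJ2: "slice_pt J2 z \<in> ball q R" if "z \<in> ball z0 r" for z
  proof -
    have "\<bar>Im (z - z0)\<bar> < R" using zR[OF that] abs_Im_le_cmod[of "z - z0"] by (simp add: dist_norm norm_minus_commute)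
    then have "\<bar>Im z\<bar> \<le> Im z0 + R" using z0 by auto
    then have "\<bar>Im z\<bar> * dist J2 I \<le> (Im z0 + R) * (R / (2 * (Im z0 + R)))"
      using J2(3) by (intro mult_mono) auto
    also have "\<dots> = R / 2"
    proof -
      have "x * (R / (2 * x)) = R / 2" if "x \<noteq> 0" for x using that by simp
      moreover have "Im z0 + R \<noteq> 0" using R(1) z0 by linarith
      ultimately show ?thesis by blast
    qed
    finally have "dist (slice_pt J2 z) (slice_pt I z) \<le> R / 2" by (simp add: dist_slice_pt_unit)
    moreover have "dist (slice_pt I z) q < R / 2"
      using that I by (simp add: z0 dist_slice_pt_same r_def dist_commute)
    ultimately show ?thesis using dist_triangle[of "slice_pt J2 z" q "slice_pt I z"]
      by (simp add: dist_commute)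
  qed
  define N where "N = I - J2"
  have N0: "N $ 0 = 0" "N \<noteq> 0" using I J2 by (simp_all add: N_def imag_unitsD)
  \<comment> \<open>Left multiplication by the octonionic inverse of \<open>N\<close>; alternativity
    makes it a two-sided inverse of left multiplication by \<open>N\<close>.\<close>
  define S where "S y = (- 1 / (norm N)\<^sup>2) *\<^sub>R (N \<odot> y)" for y
  have S_lin: "bounded_linear S"
    unfolding S_def by (intro bounded_linear_compose[OF bounded_linear_scaleR_right] oct_mult.bounded_linear_right)
  interpret S: bounded_linear S by (rule S_lin)
  have S_left: "S (N \<odot> y) = y" for y
    using N0 by (simp add: S_def imag_mult_imag_mult)
  have S_right: "N \<odot> S y = y" for y
    using N0 by (simp add: S_def oct_mult.scaleR_right oct_mult.minus_right imag_mult_imag_mult)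
  define v where "v z = S (f (slice_pt I z) - f (slice_pt J2 z))" for z
  define u where "u z = f (slice_pt I z) - I \<odot> v z" for z
  have rep: "f (slice_pt J z) = u z + J \<odot> v z"
    if J: "J \<in> imag_units" "slice_pt J z \<in> ball q R" and z: "z \<in> ball z0 r" for J z
  proof -
    obtain u' v' where uv: "\<And>K. K \<in> imag_units \<Longrightarrow> slice_pt K z \<in> ball q R \<Longrightarrow> f (slice_pt K z) = u' + K \<odot> v'"
      using slice_function_ball[OF sf, of I z0 R z] R I zR[OF z] z0 by metis
    have 1: "f (slice_pt I z) = u' + I \<odot> v'" "f (slice_pt J2 z) = u' + J2 \<odot> v'"
      using uv I J2 inI[OF z] inJ2[OF z] by blast+
    then have "f (slice_pt I z) - f (slice_pt J2 z) = N \<odot> v'" by (simp add: N_def oct_mult.diff_left)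
    then have "v z = v'" unfolding v_def using S_left by simp
    moreover from this have "u z = u'" using 1 by (simp add: u_def)
    ultimately show ?thesis using uv[OF J] by simp
  qed
  define a where "a J z = partial_deriv 0 f (slice_pt J z)" for J z
  define b where "b J z = (\<Sum>l\<in>UNIV. J $ l *\<^sub>R partial_deriv l f (slice_pt J z))" for J z
  have T: "\<exists>T. (f has_derivative T) (at (slice_pt J z)) \<and> T (oct_e 0) = a J z \<and> T J = b J z"
    if x: "slice_pt J z \<in> \<Omega>" for J z
  proof -
    obtain T where T: "(f has_derivative T) (at (slice_pt J z))"
      using C1(1)[OF x] by (auto simp: differentiable_def)
    have "T J = T (\<Sum>l\<in>UNIV. J $ l *\<^sub>R oct_e l)" using oct_expand[of J] by simp
    also have "\<dots> = b J z"
      using has_derivative_linear[OF T] by (simp add: b_def partial_deriv_eq[OF T] linear_sum linear_scale)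
    finally show ?thesis using T by (auto simp: a_def partial_deriv_eq[OF T])
  qed
  have der: "((\<lambda>z. f (slice_pt J z)) has_derivative (\<lambda>h. Re h *\<^sub>R a J z + Im h *\<^sub>R b J z)) (at z)"
    if x: "slice_pt J z \<in> \<Omega>" for J z
  proof -
    obtain T where T: "(f has_derivative T) (at (slice_pt J z))" "T (oct_e 0) = a J z" "T J = b J z"
      using T[OF x] by blast
    have "T (slice_pt J h) = Re h *\<^sub>R a J z + Im h *\<^sub>R b J z" for h
      using has_derivative_linear[OF T(1)] T(2,3)
      by (simp add: slice_pt_def oct_of_real_def linear_add linear_scale)
    then show ?thesis using has_derivative_compose[OF slice_pt_has_derivative T(1)] by simp
  qed
  have cont: "continuous_on (ball z0 r) (a J)" "continuous_on (ball z0 r) (b J)"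
    if "\<And>z. z \<in> ball z0 r \<Longrightarrow> slice_pt J z \<in> \<Omega>" for J
    unfolding a_def b_def
    by (intro continuous_intros continuous_on_compose2[OF C1(2)]; use that in blast)+
  have \<Omega>I: "slice_pt I z \<in> \<Omega>" and \<Omega>J2: "slice_pt J2 z \<in> \<Omega>" if "z \<in> ball z0 r" for z
    using inI inJ2 R(3) that by blast+
  define va vb where "va z = S (a I z - a J2 z)" and "vb z = S (b I z - b J2 z)" for z
  define ua ub where "ua z = a I z - I \<odot> va z" and "ub z = b I z - I \<odot> vb z" for z
  have ab: "a J z = ua z + J \<odot> va z" "b J z = ub z + J \<odot> vb z" if "J = I \<or> J = J2" for J z
  proof -
    have "N \<odot> va z = a I z - a J2 z" "N \<odot> vb z = b I z - b J2 z"
      by (simp_all add: va_def vb_def S_right)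
    then show "a J z = ua z + J \<odot> va z" "b J z = ub z + J \<odot> vb z"
      using that by (auto simp: ua_def ub_def N_def oct_mult.diff_left algebra_simps)
  qed
  have cont_v: "continuous_on (ball z0 r) va" "continuous_on (ball z0 r) vb"
    unfolding va_def vb_def
    by (intro S.continuous_on continuous_intros cont \<Omega>I \<Omega>J2; assumption)+
  have cont_u: "continuous_on (ball z0 r) ua" "continuous_on (ball z0 r) ub"
    unfolding ua_def ub_def
    by (intro continuous_intros oct_mult.continuous_on cont cont_v \<Omega>I; assumption)+
  have der_v: "(v has_derivative (\<lambda>h. Re h *\<^sub>R va z + Im h *\<^sub>R vb z)) (at z)" if z: "z \<in> ball z0 r" for z
  proof -
    have "(v has_derivative (\<lambda>h. S (Re h *\<^sub>R a I z + Im h *\<^sub>R b I z - (Re h *\<^sub>R a J2 z + Im h *\<^sub>R b J2 z)))) (at z)"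
      unfolding v_def by (intro S.has_derivative has_derivative_diff der \<Omega>I \<Omega>J2 z)
    moreover have "S (Re h *\<^sub>R a I z + Im h *\<^sub>R b I z - (Re h *\<^sub>R a J2 z + Im h *\<^sub>R b J2 z))
        = Re h *\<^sub>R va z + Im h *\<^sub>R vb z" for h
      by (simp add: va_def vb_def S.add S.diff S.scaleR algebra_simps)
    ultimately show ?thesis by simp
  qed
  have der_u: "(u has_derivative (\<lambda>h. Re h *\<^sub>R ua z + Im h *\<^sub>R ub z)) (at z)" if z: "z \<in> ball z0 r" for z
  proof -
    have "(u has_derivative (\<lambda>h. Re h *\<^sub>R a I z + Im h *\<^sub>R b I z - I \<odot> (Re h *\<^sub>R va z + Im h *\<^sub>R vb z))) (at z)"
      unfolding u_def
      by (intro has_derivative_diff der \<Omega>I z bounded_linear.has_derivative[OF oct_mult.bounded_linear_right] der_v)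
    moreover have "Re h *\<^sub>R a I z + Im h *\<^sub>R b I z - I \<odot> (Re h *\<^sub>R va z + Im h *\<^sub>R vb z)
        = Re h *\<^sub>R ua z + Im h *\<^sub>R ub z" for h
      by (simp add: ua_def ub_def oct_mult.add_right oct_mult.scaleR_right algebra_simps)
    ultimately show ?thesis by simp
  qed
  have pde: "a J z + J \<odot> b J z = (2 / Im z) *\<^sub>R v z"
    if z: "z \<in> ball z0 r" "Im z \<noteq> 0" and J: "J = I \<or> J = J2" for J z
  proof -
    have JU: "J \<in> imag_units" and JR: "slice_pt J z \<in> ball q R"
      using J I J2 inI[OF z(1)] inJ2[OF z(1)] by auto
    obtain T where T: "(f has_derivative T) (at (slice_pt J z))" "T (oct_e 0) = a J z" "T J = b J z"
      using T R(3) JR by blast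
    obtain e where e: "0 < e" "ball (slice_pt J z) e \<subseteq> ball q R" using JR by (meson open_ball openE)
    have "dbar_F f (slice_pt J z) = T (oct_e 0) + J \<odot> T J - (2 / Im z) *\<^sub>R v z"
    proof (rule dbar_F_slice_pt[OF JU z(2) T(1)])
      show "0 < e / \<bar>Im z\<bar>" using e z by simp
      fix K assume K: "K \<in> imag_units" "dist K J < e / \<bar>Im z\<bar>"
      then have "slice_pt K z \<in> ball (slice_pt J z) e"
        using z(2) by (simp add: dist_slice_pt_unit dist_commute[of J K] pos_less_divide_eq mult.commute)
      then show "f (slice_pt K z) = u z + K \<odot> v z" using rep K z(1) e(2) by blast
    qed
    moreover have "slice_pt J z \<in> \<Omega> - oct_reals"
      using JR R(3) slice_pt_in_reals_iff[OF JU] z(2) by blast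
    ultimately show ?thesis using dbar T(2,3) by simp
  qed
  have Iunit: "J \<odot> (J \<odot> y) = - y" if "J = I \<or> J = J2" for J y
    using that I J2 by (auto simp: imag_mult_imag_mult imag_unitsD)
  \<comment> \<open>Subtracting the equations for \<open>I\<close> and \<open>J2\<close> leaves
    \<open>N \<odot> (va z + ub z) = 0\<close>, and \<open>N\<close> can be cancelled.\<close>
  have cr: "va z + ub z = 0 \<and> ua z - vb z = (2 / Im z) *\<^sub>R v z" if z: "z \<in> ball z0 r" "Im z \<noteq> 0" for z
  proof -
    have *: "ua z - vb z + J \<odot> (va z + ub z) = (2 / Im z) *\<^sub>R v z" if "J = I \<or> J = J2" for J
      using pde[OF z that] ab[OF that] Iunit[OF that]
      by (simp add: oct_mult.add_right algebra_simps)
    have "N \<odot> (va z + ub z) = 0"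
    proof -
      have "(ua z - vb z) + I \<odot> (va z + ub z) = (ua z - vb z) + J2 \<odot> (va z + ub z)" 
        by (rule trans[OF * *[symmetric]]) simp_all
      then show ?thesis by (simp add: N_def oct_mult.diff_left)
    qed
    then have "va z + ub z = 0" using oct_mult_cancel_imag[OF N0] by blast
    then show ?thesis using *[of I] by (simp add: oct_mult.zero_right)
  qed
  \<comment> \<open>\<open>cr\<close> is available only off the real axis. This equation extends by
    continuity; the next one holds at real points because all slices meet there and so
    \<open>v = 0\<close>.\<close>
  have cr1: "ub z = - va z" if z: "z \<in> ball z0 r" for z
  proof -
    have "va z + ub z = 0"
    proof (cases "Im z = 0")
      case True
      have "isCont (\<lambda>z. va z + ub z) z"
        using continuous_on_interior[OF continuous_on_add[OF cont_v(1) cont_u(2)]] z by simp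
      moreover have "\<forall>\<^sub>F t in at (0::real). z + t *\<^sub>R \<i> \<in> ball z0 r"
        using z by (intro eventually_line_in_open) auto
      then have "\<forall>\<^sub>F t in at (0::real). va (z + t *\<^sub>R \<i>) + ub (z + t *\<^sub>R \<i>) = 0"
        using eventually_neq_at_within[of 0 0 UNIV]
        by eventually_elim (use cr True in auto)
      ultimately show ?thesis by (rule isCont_eq_const)
    qed (use cr z in blast)
    then show ?thesis by (simp add: eq_neg_iff_add_eq_0 add.commute)
  qed
  have cr2: "Im z *\<^sub>R (ua z - vb z) = 2 *\<^sub>R v z" if z: "z \<in> ball z0 r" for z
  proof (cases "Im z = 0")
    case True
    then show ?thesis by (simp add: v_def slice_pt_real S.zero)
  qed (use cr z in simp)
  show ?thesis
  proof (rule that)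
    show "0 < r" "r \<le> \<delta>" "I \<in> imag_units" "q = slice_pt I z0" using r R I z0 by auto
    show "ball q r \<subseteq> \<Omega>" using R(3) r by (meson dual_order.trans less_imp_le subset_ball)
    show "Im z0 = 0 \<or> r \<le> Im z0" using R(4) r by auto
    show "stem_system (ball z0 r) u v"
      unfolding stem_system_def using cont_u cont_v der_u der_v cr1 cr2 by blast
    show "f (slice_pt J z) = u z + J \<odot> v z"
      if "J \<in> imag_units" "z \<in> ball z0 r" "slice_pt J z \<in> ball q r" for J z
      using rep[OF that(1) _ that(2)] that(3) r by simp
  qed
qed

subsection \<open>Identity theorem and maximum principle\<close>

text \<open>The equality case of Cauchy-Schwarz, which turns a statement on the real function
  \<open>f \<bullet> c\<close> back into one on \<open>f\<close>.\<close>

lemma eq_if_inner_eq_norm_sq: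
  fixes y c :: "'a::real_inner"
  assumes "norm y \<le> norm c" "c \<bullet> c \<le> y \<bullet> c"
  shows "y = c"
proof -
  have "(norm (y - c))\<^sup>2 = (norm y)\<^sup>2 - 2 * (y \<bullet> c) + c \<bullet> c"
    by (simp add: power2_norm_eq_inner inner_diff_left inner_diff_right inner_commute)
  also have "\<dots> \<le> 0"
    using assms(2) power_mono[OF assms(1), of 2] by (simp add: power2_norm_eq_inner)
  finally show ?thesis by simp
qed

lemma inner_le_inner_self:
  fixes y c :: "'a::real_inner"
  assumes "norm y \<le> norm c"
  shows "y \<bullet> c \<le> c \<bullet> c"
proof -
  have "y \<bullet> c \<le> norm y * norm c" by (rule norm_cauchy_schwarz)
  also have "\<dots> \<le> norm c * norm c" using assms by (rule mult_right_mono) simp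
  finally show ?thesis by (simp flip: power2_norm_eq_inner power2_eq_square)
qed

lemma eq_const_on_ball_if_nonreal:
  fixes f :: "octonion \<Rightarrow> 'b::t2_space"
  assumes cont: "continuous_on (ball q r) f" and x: "x \<in> ball q r"
    and nonreal: "\<And>J z. J \<in> imag_units \<Longrightarrow> Im z \<noteq> 0 \<Longrightarrow> 0 \<le> Im z \<Longrightarrow> slice_pt J z \<in> ball q r \<Longrightarrow> f (slice_pt J z) = c"
  shows "f x = c"
proof (cases "x \<in> oct_reals")
  case False
  obtain J z where Jz: "J \<in> imag_units" "0 \<le> Im z" "x = slice_pt J z" by (rule slice_pt_cases)
  then show ?thesis using nonreal[of J z] x False slice_pt_in_reals_iff by blast
next
  case True
  obtain a where a: "x = oct_of_real a" using True by (auto simp: oct_reals_def)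
  obtain J where J: "J \<in> imag_units" by (rule imag_unit_exists)
  have "isCont f x" using continuous_on_interior[OF cont] x by simp
  moreover have "\<forall>\<^sub>F t in at (0::real). x + t *\<^sub>R J \<in> ball q r"
    using x by (intro eventually_line_in_open) auto
  then have "\<forall>\<^sub>F t in at (0::real). f (x + t *\<^sub>R J) = c"
    using eventually_neq_at_within[of 0 0 UNIV]
  proof eventually_elim
    case (elim t)
    have 1: "x + t *\<^sub>R J = slice_pt J (Complex a t)" "x + t *\<^sub>R J = slice_pt (- J) (Complex a (- t))"
      by (simp_all add: slice_pt_def a)
    show ?case
    proof (cases "0 \<le> t")
      case True then show ?thesis using nonreal[OF J, of "Complex a t"] elim 1(1) by simp
    next
      case False
      then show ?thesis
        using nonreal[OF imag_units_minus[OF J], of "Complex a (- t)"] elim 1(2) by simp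
    qed
  qed
  ultimately show ?thesis by (rule isCont_eq_const)
qed

lemma slice_pt_cases_ball:
  assumes "J \<in> imag_units" "I \<in> imag_units" "0 \<le> Im z" "0 \<le> Im z0" "slice_pt J z \<in> ball (slice_pt I z0) r"
  shows "z \<in> ball z0 r"
  using dist_le_dist_slice_pt[OF assms(2,1,4,3)] assms(5) by simp

text \<open>One slice through \<open>N\<close> gives only the combination \<open>u + J v\<close>.
  Starting from a nonreal point of \<open>N\<close>, two nearby slices meet \<open>N\<close> over a
  common open set of coordinates; there \<open>u = c\<close> and \<open>v = 0\<close>, and
  \<open>stem_system_unique\<close> spreads this coordinatewise.\<close>

lemma slice_Fueter_local_unique:
  assumes r: "0 < r" and I: "I \<in> imag_units" and z0: "0 \<le> Im z0" and q: "q = slice_pt I z0"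
    and sys: "stem_system (ball z0 r) u v"
    and rep: "\<And>J z. J \<in> imag_units \<Longrightarrow> z \<in> ball z0 r \<Longrightarrow> slice_pt J z \<in> ball q r \<Longrightarrow> f (slice_pt J z) = u z + J \<odot> v z"
    and cont: "continuous_on (ball q r) f"
    and N: "open N" "N \<subseteq> ball q r" "N \<noteq> {}" "\<And>x. x \<in> N \<Longrightarrow> f x = c"
    and x: "x \<in> ball q r"
  shows "f x = c"
proof -
  obtain y where y: "y \<in> N" "y \<notin> oct_reals"
  proof -
    obtain y where y: "y \<in> N" using N(3) by blast
    show ?thesis
    proof (cases "y \<in> oct_reals")
      case True
      then obtain a where a: "y = oct_of_real a" by (auto simp: oct_reals_def)
      have ev: "\<forall>\<^sub>F t in at (0::real). y + t *\<^sub>R I \<in> N \<and> t \<noteq> 0"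
        using eventually_line_in_open[OF N(1) y] eventually_neq_at_within[of 0 0 UNIV]
        by (rule eventually_conj)
      then obtain t where t: "y + t *\<^sub>R I \<in> N" "t \<noteq> 0" using eventually_happens'[OF _ ev] by auto
      moreover have "y + t *\<^sub>R I = slice_pt I (Complex a t)" by (simp add: slice_pt_def a)
      ultimately show ?thesis using that slice_pt_in_reals_iff[OF I, of "Complex a t"] by simp
    qed (use y that in blast)
  qed
  obtain J1 z1 where J1: "J1 \<in> imag_units" "0 \<le> Im z1" "y = slice_pt J1 z1" by (rule slice_pt_cases)
  have "Im z1 \<noteq> 0" using y J1 slice_pt_in_reals_iff by blast
  then have b1: "0 < Im z1" using J1(2) by simp
  obtain e where e: "0 < e" "ball y e \<subseteq> N" using N(1) y(1) by (rule openE)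
  obtain J2 where J2: "J2 \<in> imag_units" "J2 \<noteq> J1" "dist J2 J1 < e / Im z1"
    using imag_unit_near[OF J1(1), of "e / Im z1"] e b1 by auto
  have "slice_pt J2 z1 \<in> ball y e"
    using J2(3) b1 by (simp add: J1 dist_slice_pt_unit dist_commute[of J1] pos_less_divide_eq mult.commute)
  then have J2N: "slice_pt J2 z1 \<in> N" using e by blast
  define M where "M = ball z0 r \<inter> (slice_pt J1 -` N \<inter> slice_pt J2 -` N)"
  have "open M"
    unfolding M_def using N(1)
    by (intro open_Int open_ball open_vimage continuous_intros)
  have "y \<in> ball q r" using y N by blast
  then have z1: "z1 \<in> ball z0 r"
    using slice_pt_cases_ball[OF J1(1) I J1(2) z0] J1(3) q by simp
  then have "M \<noteq> {}" using y(1) J1(3) J2N by (auto simp: M_def)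
  have M0: "u z = c \<and> v z = 0" if z: "z \<in> M" for z
  proof -
    have "c = u z + J1 \<odot> v z" "c = u z + J2 \<odot> v z"
      using rep[OF J1(1), of z] rep[OF J2(1), of z] N(2,4) z unfolding M_def by blast+
    then have "(J1 - J2) \<odot> v z = 0" by (simp add: oct_mult.diff_left algebra_simps)
    then have "v z = 0" 
      by (rule oct_mult_cancel_imag[of "J1 - J2", rotated 2]) (use J1(1) J2(1,2) in \<open>simp_all add: imag_unitsD\<close>)
    then show ?thesis using \<open>c = u z + J1 \<odot> v z\<close> by (simp add: oct_mult.zero_right)
  qed
  have uv: "u z = c \<and> v z = 0" if z: "z \<in> ball z0 r" "Im z \<noteq> 0" for z
  proof -
    have "(u z - c) $ k = 0 \<and> v z $ k = 0" for k
      by (rule stem_system_unique[OF open_ball convex_ball stem_system_linear[OF sys bounded_linear_vec_nth, of c k] \<open>open M\<close> _ \<open>M \<noteq> {}\<close> _ z])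
         (use M0 in \<open>auto simp: M_def\<close>)
    then show ?thesis by (simp add: vec_eq_iff)
  qed
  show ?thesis
  proof (rule eq_const_on_ball_if_nonreal[OF cont x])
    fix J z assume Jz: "J \<in> imag_units" "Im z \<noteq> 0" "0 \<le> Im z" "slice_pt J z \<in> ball q r"
    have "z \<in> ball z0 r" using slice_pt_cases_ball[OF Jz(1) I Jz(3) z0] Jz(4) q by simp
    then show "f (slice_pt J z) = c" using rep Jz uv by (simp add: oct_mult.zero_right)
  qed
qed

text \<open>\<open>f \<bullet> c\<close> is averaged over two points whose mean is a real stem
  expression: \<open>J\<close> and \<open>- J\<close> about a real centre, two units symmetric about
  \<open>I\<close> otherwise. When the mean attains the bound \<open>c \<bullet> c\<close>, both
  points do.\<close>

lemma slice_Fueter_local_max: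
  assumes r: "0 < r" and I: "I \<in> imag_units" and z0: "Im z0 = 0 \<or> r \<le> Im z0" and q: "q = slice_pt I z0"
    and sys: "stem_system (ball z0 r) u v"
    and rep: "\<And>J z. J \<in> imag_units \<Longrightarrow> z \<in> ball z0 r \<Longrightarrow> slice_pt J z \<in> ball q r \<Longrightarrow> f (slice_pt J z) = u z + J \<odot> v z"
    and cont: "continuous_on (ball q r) f"
    and max: "\<And>x. x \<in> ball q r \<Longrightarrow> norm (f x) \<le> norm (f q)"
    and x: "x \<in> ball q r"
  shows "f x = f q"
proof -
  define c where "c = f q"
  have b0: "0 \<le> Im z0" using z0 r by auto
  have le: "f x \<bullet> c \<le> c \<bullet> c" if "x \<in> ball q r" for x
    using max[OF that] by (simp add: c_def inner_le_inner_self)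
  have eqI: "f x = c" if "x \<in> ball q r" "c \<bullet> c \<le> f x \<bullet> c" for x
    using eq_if_inner_eq_norm_sq[OF _ that(2)] max[OF that(1)] by (simp add: c_def)
  have z0r: "z0 \<in> ball z0 r" and qr: "q \<in> ball q r" using r by auto
  have sysU: "stem_system (ball z0 r) (\<lambda>z. (u z - c) \<bullet> c) (\<lambda>z. v z \<bullet> c)"
    by (rule stem_system_linear[OF sys bounded_linear_inner_left])
  have "f x = c" using z0
  proof
    assume real: "Im z0 = 0"
    then have z0_eq: "z0 = of_real (Re z0)" by (simp add: complex_eq_iff)
    have in_ball: "slice_pt J z \<in> ball q r" if "J \<in> imag_units" "z \<in> ball z0 r" for J z
    proof -
      have "q = slice_pt J z0" using real by (simp add: q slice_pt_real)
      then show ?thesis using that by (simp add: dist_slice_pt_same)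
    qed
    have sum: "f (slice_pt J z) + f (slice_pt (- J) z) = 2 *\<^sub>R u z" if "J \<in> imag_units" "z \<in> ball z0 r" for J z
      using rep in_ball that imag_units_minus[OF that(1)] by (simp add: oct_mult.minus_left scaleR_2)
    have sum_c: "f (slice_pt J z) \<bullet> c + f (slice_pt (- J) z) \<bullet> c = 2 * (u z \<bullet> c)"
      if "J \<in> imag_units" "z \<in> ball z0 r" for J z
      using arg_cong[OF sum[OF that], of "\<lambda>y. y \<bullet> c"] by (simp add: inner_add_left)
    have U: "(u z - c) \<bullet> c = 0" if z: "z \<in> ball z0 r" "Im z \<noteq> 0" for z
    proof (rule stem_system_max_real[OF r, of "Re z0"])
      show "stem_system (ball (of_real (Re z0)) r) (\<lambda>z. (u z - c) \<bullet> c) (\<lambda>z. v z \<bullet> c)"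
        using sysU z0_eq by simp
      show "(u z - c) \<bullet> c \<le> 0" if "z \<in> ball (of_real (Re z0)) r" for z
      proof -
        have z: "z \<in> ball z0 r" using that z0_eq by simp
        show ?thesis
          using sum_c[OF I z] le[OF in_ball[OF I z]] le[OF in_ball[OF imag_units_minus[OF I] z]]
          by (simp add: inner_diff_left)
      qed
      have "slice_pt (- I) z0 = q" using real by (simp add: q slice_pt_real)
      then have "u z0 = c" using sum[OF I z0r] by (simp add: c_def flip: q scaleR_2)
      then show "(u (of_real (Re z0)) - c) \<bullet> c = 0" using z0_eq by simp
      show "z \<in> ball (of_real (Re z0)) r" using z z0_eq by simp
    qed (rule z)
    show ?thesis
    proof (rule eq_const_on_ball_if_nonreal[OF cont x])
      fix J z assume Jz: "J \<in> imag_units" "Im z \<noteq> 0" "0 \<le> Im z" "slice_pt J z \<in> ball q r"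
      have z: "z \<in> ball z0 r" using slice_pt_cases_ball[OF Jz(1) I Jz(3) b0] Jz(4) q by simp
      have "c \<bullet> c \<le> f (slice_pt J z) \<bullet> c"
        using sum_c[OF Jz(1) z] U[OF z Jz(2)] le[OF in_ball[OF imag_units_minus[OF Jz(1)] z]]
        by (simp add: inner_diff_left)
      then show "f (slice_pt J z) = c" by (rule eqI[OF Jz(4)])
    qed
  next
    assume nonreal: "r \<le> Im z0"
    then have b0: "0 < Im z0" using r by simp
    have "bounded_linear (\<lambda>y. (I \<odot> y) \<bullet> c)"
      by (rule bounded_linear_compose[OF bounded_linear_inner_left oct_mult.bounded_linear_right])
    then have sysV: "stem_system (ball z0 r) (\<lambda>z. (I \<odot> (u z - 0)) \<bullet> c) (\<lambda>z. (I \<odot> v z) \<bullet> c)"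
      by (rule stem_system_linear[OF sys])
    have UV: "(u z - c) \<bullet> c = 0 \<and> (I \<odot> v z) \<bullet> c = 0" if "z \<in> ball z0 r" for z
    proof (rule stem_system_max_nonreal[OF r nonreal sysU sysV _ _ that])
      show "(u z0 - c) \<bullet> c + (I \<odot> v z0) \<bullet> c = 0"
        using rep[OF I z0r] qr unfolding c_def q by (simp add: inner_diff_left inner_add_left)
      fix z s assume s: "\<bar>Im z - Im z0\<bar> \<le> s" "(Re z - Re z0)\<^sup>2 + s\<^sup>2 < r\<^sup>2"
      define \<tau> where "\<tau> = ((Im z)\<^sup>2 + (Im z0)\<^sup>2 - s\<^sup>2) / (2 * Im z0 * Im z)"
      have s0: "0 \<le> s" using s(1) by linarith
      have "s\<^sup>2 < r\<^sup>2" using s(2) zero_le_power2[of "Re z - Re z0"] by linarith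
      then have sr: "s < r" using r by (simp add: power2_less_imp_less)
      then have b: "0 < Im z" using s(1) nonreal by linarith
      have "(Im z - Im z0)\<^sup>2 \<le> s\<^sup>2" using s(1) s0 by (simp add: abs_le_square_iff[symmetric])
      then have zr: "z \<in> ball z0 r"
      proof -
        have "(dist z0 z)\<^sup>2 = (Re z - Re z0)\<^sup>2 + (Im z - Im z0)\<^sup>2"
          by (simp add: dist_norm cmod_power2 power2_commute)
        then have "(dist z0 z)\<^sup>2 < r\<^sup>2" using s(2) \<open>(Im z - Im z0)\<^sup>2 \<le> s\<^sup>2\<close> by linarith
        then show ?thesis using r by (simp add: power2_less_imp_less)
      qed
      have \<tau>_mult: "2 * Im z0 * Im z * \<tau> = (Im z)\<^sup>2 + (Im z0)\<^sup>2 - s\<^sup>2" using b b0 by (simp add: \<tau>_def)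
      have "\<tau> \<le> 1"
        unfolding \<tau>_def using b b0 \<open>(Im z - Im z0)\<^sup>2 \<le> s\<^sup>2\<close> by (simp add: power2_diff mult.commute mult.left_commute)
      moreover have "- 1 \<le> \<tau>"
      proof -
        have "s \<le> Im z0" using sr nonreal by simp
        then have "s\<^sup>2 \<le> (Im z0)\<^sup>2" using s0 by (rule power_mono)
        then have "0 \<le> (Im z)\<^sup>2 + (Im z0)\<^sup>2 - s\<^sup>2"
          using zero_le_power2[of "Im z"] by linarith
        then have "0 \<le> \<tau>" unfolding \<tau>_def using b b0 by (intro divide_nonneg_pos) auto
        then show ?thesis by simp
      qed
      ultimately have "\<tau>\<^sup>2 \<le> 1" by (simp add: abs_square_le_1)
      then have unit: "\<tau>\<^sup>2 + (sqrt (1 - \<tau>\<^sup>2))\<^sup>2 = 1" by simp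
      obtain N where N: "N \<in> imag_units" "I \<bullet> N = 0" by (rule imag_unit_orthogonal[OF I])
      \<comment> \<open>Units at cosine \<open>\<tau>\<close> to \<open>I\<close> put the points at
        distance \<open>s\<close> from the axis by the law of cosines. The components along
        \<open>N\<close> for the two signs of \<open>\<sigma>\<close> cancel in the average.\<close>
      define K where "K \<sigma> = \<tau> *\<^sub>R I + \<sigma> *\<^sub>R N" for \<sigma>
      have fK: "f (slice_pt (K \<sigma>) z) = u z + K \<sigma> \<odot> v z \<and> f (slice_pt (K \<sigma>) z) \<bullet> c \<le> c \<bullet> c"
        if \<sigma>: "\<sigma>\<^sup>2 = 1 - \<tau>\<^sup>2" for \<sigma>
      proof -
        have K: "K \<sigma> \<in> imag_units" unfolding K_def by (rule imag_units_combine[OF I N]) (simp add: \<sigma>)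
        have "I \<bullet> I = 1" using I by (simp add: imag_unitsD flip: power2_norm_eq_inner)
        then have "I \<bullet> K \<sigma> = \<tau>" using N(2) by (simp add: K_def inner_add_right)
        then have "(dist q (slice_pt (K \<sigma>) z))\<^sup>2 = (Re z0 - Re z)\<^sup>2 + s\<^sup>2"
          using \<tau>_mult unfolding q dist_slice_pt[OF I K] by simp
        then have "(dist q (slice_pt (K \<sigma>) z))\<^sup>2 < r\<^sup>2" using s(2) by (simp add: power2_commute)
        then have "slice_pt (K \<sigma>) z \<in> ball q r" using r by (simp add: power2_less_imp_less)
        then show ?thesis using rep[OF K zr] le by metis
      qed
      let ?s = "sqrt (1 - \<tau>\<^sup>2)"
      have "?s\<^sup>2 = 1 - \<tau>\<^sup>2" "(- ?s)\<^sup>2 = 1 - \<tau>\<^sup>2" using \<open>\<tau>\<^sup>2 \<le> 1\<close> by simp_all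
      from fK[OF this(1)] fK[OF this(2)]
      have "(u z + K ?s \<odot> v z) \<bullet> c \<le> c \<bullet> c" "(u z + K (- ?s) \<odot> v z) \<bullet> c \<le> c \<bullet> c" by auto
      then have "(u z - c) \<bullet> c + \<tau> * ((I \<odot> v z) \<bullet> c) \<le> 0"
        by (simp add: K_def oct_mult.add_left oct_mult.scaleR_left oct_mult.diff_left inner_add_left inner_diff_left)
      then show "(u z - c) \<bullet> c + ((Im z)\<^sup>2 + (Im z0)\<^sup>2 - s\<^sup>2) / (2 * Im z0 * Im z) * ((I \<odot> v z) \<bullet> c) \<le> 0"
        by (simp add: \<tau>_def)
    qed
    show ?thesis
    proof (rule eq_const_on_ball_if_nonreal[OF cont x])
      fix J z assume Jz: "J \<in> imag_units" "Im z \<noteq> 0" "0 \<le> Im z" "slice_pt J z \<in> ball q r"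
      have z: "z \<in> ball z0 r" using slice_pt_cases_ball[OF Jz(1) I Jz(3) _ ] b0 Jz(4) q by simp
      \<comment> \<open>the reflection of \<open>J\<close> in the line through \<open>I\<close>\<close>
      define K where "K = (2 * (I \<bullet> J)) *\<^sub>R I - J"
      have II: "I \<bullet> I = 1" "J \<bullet> J = 1" using I Jz(1) by (simp_all add: imag_unitsD flip: power2_norm_eq_inner)
      have "K \<bullet> K = 1"
        using II by (simp add: K_def inner_diff_left inner_diff_right inner_commute[of J I])
      then have K: "K \<in> imag_units"
        using I Jz(1) by (intro imag_unitsI) (simp_all add: K_def imag_unitsD norm_eq_1)
      have "I \<bullet> K = I \<bullet> J" using II by (simp add: K_def inner_diff_right)
      then have "(dist q (slice_pt K z))\<^sup>2 = (dist q (slice_pt J z))\<^sup>2"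
        unfolding q dist_slice_pt[OF I K] dist_slice_pt[OF I Jz(1)] by simp
      then have Kz: "slice_pt K z \<in> ball q r" using Jz(4) by simp
      have "f (slice_pt J z) \<bullet> c + f (slice_pt K z) \<bullet> c = 2 * (u z \<bullet> c) + 2 * (I \<bullet> J) * ((I \<odot> v z) \<bullet> c)"
        using rep[OF Jz(1) z Jz(4)] rep[OF K z Kz]
        by (simp add: K_def oct_mult.diff_left oct_mult.scaleR_left inner_add_left inner_diff_left)
      then have "c \<bullet> c \<le> f (slice_pt J z) \<bullet> c"
        using UV[OF z] le[OF Kz] by (simp add: inner_diff_left)
      then show "f (slice_pt J z) = c" by (rule eqI[OF Jz(4)])
    qed
  qed
  then show ?thesis by (simp add: c_def)
qed

theorem corollary3p14:
  fixes \<Omega> :: "octonion set" and f :: "octonion \<Rightarrow> octonion"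
  assumes "open \<Omega>" and "connected \<Omega>" and "\<Omega> \<noteq> {}"
    and "slice_Fueter_regular \<Omega> f"
    and "\<not> f constant_on \<Omega>"
  shows "\<not> (\<exists>p\<in>\<Omega>. \<forall>\<^sub>F x in at p within \<Omega>. norm (f x) \<le> norm (f p))"
proof
  assume "\<exists>p\<in>\<Omega>. \<forall>\<^sub>F x in at p within \<Omega>. norm (f x) \<le> norm (f p)"
  then obtain p where p: "p \<in> \<Omega>" and "\<forall>\<^sub>F x in at p within \<Omega>. norm (f x) \<le> norm (f p)" by blast
  then have "\<forall>\<^sub>F x in at p. norm (f x) \<le> norm (f p)" by (simp only: at_within_open[OF p assms(1)])
  then obtain d where d: "0 < d" "\<And>x. x \<noteq> p \<Longrightarrow> dist x p < d \<Longrightarrow> norm (f x) \<le> norm (f p)"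
    unfolding eventually_at by blast
  have cont: "continuous_on \<Omega> f"
    using assms(4) unfolding slice_Fueter_regular_def oct_C1_on_def
    by (intro continuous_at_imp_continuous_on ballI differentiable_imp_continuous_within) blast
  \<comment> \<open>The interior is taken because the local identity theorem starts from an open set
    on which \<open>f\<close> is constant.\<close>
  define Z where "Z = interior {x \<in> \<Omega>. f x = f p}"
  have "open Z" by (simp add: Z_def)
  have ZI: "q \<in> Z" if "0 < r" "ball q r \<subseteq> \<Omega>" "\<And>x. x \<in> ball q r \<Longrightarrow> f x = f p" for q r
    unfolding Z_def by (rule interiorI[of "ball q r"]) (use that in auto)
  have "p \<in> Z"
  proof -
    obtain r I z0 u v where *: "0 < r" "r \<le> d" "I \<in> imag_units" "p = slice_pt I z0"
      "ball p r \<subseteq> \<Omega>" "Im z0 = 0 \<or> r \<le> Im z0" "stem_system (ball z0 r) u v"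
      "\<And>J z. J \<in> imag_units \<Longrightarrow> z \<in> ball z0 r \<Longrightarrow> slice_pt J z \<in> ball p r \<Longrightarrow> f (slice_pt J z) = u z + J \<odot> v z"
      by (rule slice_Fueter_local_stem[OF assms(1,4) p d(1)]) blast
    have le: "norm (f x) \<le> norm (f p)" if "x \<in> ball p r" for x
      using d(2)[of x] that *(2) by (cases "x = p") (auto simp: dist_commute)
    have "f x = f p" if "x \<in> ball p r" for x
      by (rule slice_Fueter_local_max[OF *(1,3,6,4,7,8) continuous_on_subset[OF cont *(5)] le that])
    then show ?thesis by (rule ZI[OF *(1,5)])
  qed
  moreover have "open (\<Omega> - Z)"
    unfolding open_subopen[of "\<Omega> - Z"]
  proof
    fix q assume q: "q \<in> \<Omega> - Z"
    then have "q \<in> \<Omega>" by simp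
    obtain r I z0 u v where *: "0 < r" "r \<le> 1" "I \<in> imag_units" "q = slice_pt I z0"
      "ball q r \<subseteq> \<Omega>" "Im z0 = 0 \<or> r \<le> Im z0" "stem_system (ball z0 r) u v"
      "\<And>J z. J \<in> imag_units \<Longrightarrow> z \<in> ball z0 r \<Longrightarrow> slice_pt J z \<in> ball q r \<Longrightarrow> f (slice_pt J z) = u z + J \<odot> v z"
      by (rule slice_Fueter_local_stem[OF assms(1,4) \<open>q \<in> \<Omega>\<close> zero_less_one]) blast
    have "Im z0 \<ge> 0" using *(1,6) by auto
    \<comment> \<open>Otherwise the identity theorem would spread the value \<open>f p\<close> over
      the whole ball and put \<open>q\<close> into \<open>Z\<close>.\<close>
    have "Z \<inter> ball q r = {}"
    proof (rule ccontr)
      assume ne: "Z \<inter> ball q r \<noteq> {}"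
      have "f x = f p" if "x \<in> ball q r" for x
      proof (rule slice_Fueter_local_unique[OF *(1,3) \<open>Im z0 \<ge> 0\<close> *(4,7,8) continuous_on_subset[OF cont *(5)] _ _ ne _ that])
        show "open (Z \<inter> ball q r)" by (intro open_Int open_ball \<open>open Z\<close>)
        show "f y = f p" if "y \<in> Z \<inter> ball q r" for y
          using that interior_subset unfolding Z_def by blast
      qed auto
      then have "q \<in> Z" by (rule ZI[OF *(1,5)])
      then show False using q by simp
    qed
    then show "\<exists>T. open T \<and> q \<in> T \<and> T \<subseteq> \<Omega> - Z"
      using *(1,5) by (intro exI[of _ "ball q r"]) auto
  qed
  moreover have "Z \<subseteq> \<Omega>" unfolding Z_def using interior_subset by blast
  ultimately have "\<Omega> - Z = {}"
    using connectedD[OF assms(2) \<open>open Z\<close>, of "\<Omega> - Z"] p by blast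
  then have "\<forall>x\<in>\<Omega>. f x = f p"
    using interior_subset unfolding Z_def by blast
  then show False using assms(5) unfolding constant_on_def by blast
qed

end
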